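(* Let $n\ge 1$. The Riemannian manifold $(SPD(n),g_W)$ is geodesically convex: for any two points $A_1,A_2\in SPD(n)$ there exists a minimal geodesic of $g_W$ joining them, namely $$\gamma(t)=(1-t)^2A_1+t(1-t)\left[(A_1A_2)^{\frac12}+(A_2A_1)^{\frac12}\right]+t^2A_2,\qquad t\in[0,1],$$ and $\gamma(t)\in SPD(n)$ for every $t\in[0,1]$.
   Context: $SPD(n)$ is the set of real symmetric positive-definite $n\times n$ matrices, an open subset of the space $Sym(n)$ of real symmetric matrices, so $T_ASPD(n)\cong Sym(n)$. For $A\in SPD(n)$ and a real $n\times n$ matrix $X$, $\Gamma_A[X]$ denotes the unique real matrix satisfying $A\,\Gamma_A[X]+\Gamma_A[X]\,A=X$. The Wasserstein metric is the Riemannian metric $g_W|_A(X,Y)=\mathrm{tr}(\Gamma_A[Y]\,A\,\Gamma_A[X])=\frac12\mathrm{tr}(\Gamma_A[Y]X)$ for $X,Y\in T_ASPD(n)$. For $A_1,A_2\in SPD(n)$, $(A_1A_2)^{1/2}$ is the unique square root of $A_1A_2$ all of whose eigenvalues are positive. A minimal geodesic joining two points is a geodesic between them whose length equals their Riemannian distance. *)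

theory Defs
  imports "HOL-Analysis.Analysis"
begin

section \<open>Riemannian metrics on an open subset of a linear space\<close>

text \<open>
  In this section \<open>M\<close> is a relatively open subset of a finite-dimensional linear subspace \<open>V\<close>,
  so that every tangent space of \<open>M\<close> is \<open>V\<close>, and \<open>g p X Y\<close> is the value at \<open>p \<in> M\<close> of the
  Riemannian metric on \<open>X, Y \<in> V\<close>.
\<close>

text \<open>The derivative of \<open>p \<mapsto> g p X Y\<close> in the direction \<open>Z\<close>, with \<open>X\<close>, \<open>Y\<close> held constant.\<close>

definition metric_deriv ::
  "('a::real_normed_vector \<Rightarrow> 'a \<Rightarrow> 'a \<Rightarrow> real) \<Rightarrow> 'a \<Rightarrow> 'a \<Rightarrow> 'a \<Rightarrow> 'a \<Rightarrow> real" where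
  "metric_deriv g p Z X Y = deriv (\<lambda>s. g (p + s *\<^sub>R Z) X Y) 0"

text \<open>
  The Christoffel symbols of the Levi-Civita connection, in coordinate-free form:
  \<open>\<Gamma>\<^sup>k\<^sub>i\<^sub>j = 1/2 g\<^sup>k\<^sup>l (\<partial>\<^sub>i g\<^sub>j\<^sub>l + \<partial>\<^sub>j g\<^sub>i\<^sub>l - \<partial>\<^sub>l g\<^sub>i\<^sub>j)\<close>, with \<open>X\<close>, \<open>Y\<close>, \<open>Z\<close> in the
  roles of the indices \<open>i\<close>, \<open>j\<close>, \<open>l\<close>.
\<close>

definition christoffel ::
  "'a::real_normed_vector set \<Rightarrow> ('a \<Rightarrow> 'a \<Rightarrow> 'a \<Rightarrow> real) \<Rightarrow> 'a \<Rightarrow> 'a \<Rightarrow> 'a \<Rightarrow> 'a" where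
  "christoffel V g p X Y =
     (THE W. W \<in> V \<and> (\<forall>Z\<in>V. g p W Z =
        (metric_deriv g p X Y Z + metric_deriv g p Y X Z - metric_deriv g p Z X Y) / 2))"

text \<open>Derivatives at the endpoints of a parameter interval are one-sided throughout.\<close>

definition velocity :: "real \<Rightarrow> real \<Rightarrow> (real \<Rightarrow> 'a::real_normed_vector) \<Rightarrow> real \<Rightarrow> 'a" where
  "velocity a b c t = vector_derivative c (at t within {a..b})"

definition smooth_curve :: "real \<Rightarrow> real \<Rightarrow> (real \<Rightarrow> 'a::real_normed_vector) \<Rightarrow> bool" where
  "smooth_curve a b c \<longleftrightarrow>
     (\<exists>D :: nat \<Rightarrow> real \<Rightarrow> 'a. D 0 = c \<and>
        (\<forall>k. \<forall>t\<in>{a..b}. (D k has_vector_derivative D (Suc k) t) (at t within {a..b})))"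

text \<open>The defining equation says that the covariant acceleration of \<open>c\<close> vanishes.\<close>

definition geodesic ::
  "'a::real_normed_vector set \<Rightarrow> 'a set \<Rightarrow> ('a \<Rightarrow> 'a \<Rightarrow> 'a \<Rightarrow> real) \<Rightarrow>
   real \<Rightarrow> real \<Rightarrow> (real \<Rightarrow> 'a) \<Rightarrow> bool" where
  "geodesic V M g a b c \<longleftrightarrow>
     a < b \<and> smooth_curve a b c \<and> (\<forall>t\<in>{a..b}. c t \<in> M) \<and>
     (\<forall>t\<in>{a..b}. velocity a b (velocity a b c) t +
        christoffel V g (c t) (velocity a b c t) (velocity a b c t) = 0)"

definition C1_curve :: "real \<Rightarrow> real \<Rightarrow> (real \<Rightarrow> 'a::real_normed_vector) \<Rightarrow> bool" where
  "C1_curve a b c \<longleftrightarrow>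
     (\<exists>D. continuous_on {a..b} D \<and>
        (\<forall>t\<in>{a..b}. (c has_vector_derivative D t) (at t within {a..b})))"

text \<open>
  Unlike \<^const>\<open>piecewise_C1_differentiable_on\<close>, this requires the derivative to extend
  continuously to the break points. It is therefore bounded, and the integral in
  \<open>riem_length\<close> below exists.
\<close>

definition piecewise_C1_curve :: "real \<Rightarrow> real \<Rightarrow> (real \<Rightarrow> 'a::real_normed_vector) \<Rightarrow> bool" where
  "piecewise_C1_curve a b c \<longleftrightarrow>
     (\<exists>(m::nat) (s::nat \<Rightarrow> real). s 0 = a \<and> s m = b \<and>
        (\<forall>i<m. s i < s (Suc i) \<and> C1_curve (s i) (s (Suc i)) c))"

definition riem_length ::
  "('a::real_normed_vector \<Rightarrow> 'a \<Rightarrow> 'a \<Rightarrow> real) \<Rightarrow> real \<Rightarrow> real \<Rightarrow> (real \<Rightarrow> 'a) \<Rightarrow> real" where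
  "riem_length g a b c =
     integral {a..b} (\<lambda>t. sqrt (g (c t) (velocity a b c t) (velocity a b c t)))"

definition riem_dist ::
  "'a::real_normed_vector set \<Rightarrow> ('a \<Rightarrow> 'a \<Rightarrow> 'a \<Rightarrow> real) \<Rightarrow> 'a \<Rightarrow> 'a \<Rightarrow> real" where
  "riem_dist M g p q =
     Inf {riem_length g a b c | a b c.
            a < b \<and> piecewise_C1_curve a b c \<and> (\<forall>t\<in>{a..b}. c t \<in> M) \<and> c a = p \<and> c b = q}"

definition minimal_geodesic ::
  "'a::real_normed_vector set \<Rightarrow> 'a set \<Rightarrow> ('a \<Rightarrow> 'a \<Rightarrow> 'a \<Rightarrow> real) \<Rightarrow>
   'a \<Rightarrow> 'a \<Rightarrow> (real \<Rightarrow> 'a) \<Rightarrow> bool" where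
  "minimal_geodesic V M g p q c \<longleftrightarrow>
     geodesic V M g 0 1 c \<and> c 0 = p \<and> c 1 = q \<and> riem_length g 0 1 c = riem_dist M g p q"

definition geodesically_convex ::
  "'a::real_normed_vector set \<Rightarrow> 'a set \<Rightarrow> ('a \<Rightarrow> 'a \<Rightarrow> 'a \<Rightarrow> real) \<Rightarrow> bool" where
  "geodesically_convex V M g \<longleftrightarrow> (\<forall>p\<in>M. \<forall>q\<in>M. \<exists>c. minimal_geodesic V M g p q c)"


section \<open>Positive definite matrices and the Wasserstein metric\<close>

definition Sym :: "(real^'n^'n) set" where
  "Sym = {A. transpose A = A}"

definition SPD :: "(real^'n^'n) set" where
  "SPD = {A. A \<in> Sym \<and> (\<forall>x. x \<noteq> 0 \<longrightarrow> x \<bullet> (A *v x) > 0)}"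

text \<open>The solution \<open>\<Gamma>\<^sub>A[X]\<close> of the Lyapunov (Sylvester) equation.\<close>

definition lyapunov :: "real^'n^'n \<Rightarrow> real^'n^'n \<Rightarrow> real^'n^'n" where
  "lyapunov A X = (THE G. A ** G + G ** A = X)"

definition wasserstein_metric :: "real^'n^'n \<Rightarrow> real^'n^'n \<Rightarrow> real^'n^'n \<Rightarrow> real" where
  "wasserstein_metric A X Y = trace (lyapunov A Y ** A ** lyapunov A X)"

text \<open>Complex eigenvalues, so that a real matrix has its full spectrum.\<close>

definition eigenvalue :: "real^'n^'n \<Rightarrow> complex \<Rightarrow> bool" where
  "eigenvalue M l \<longleftrightarrow> (\<exists>v::complex^'n. v \<noteq> 0 \<and> map_matrix complex_of_real M *v v = l *s v)"

definition positive_sqrt :: "real^'n^'n \<Rightarrow> real^'n^'n" where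
  "positive_sqrt M =
     (THE S. S ** S = M \<and> (\<forall>l. eigenvalue S l \<longrightarrow> l \<in> \<real> \<and> 0 < Re l))"

end

theory Submission
  imports Defs
begin

text \<open>
  For \<open>A\<^sub>1, A\<^sub>2\<close> in \<open>SPD\<close> there is \<open>T \<in> SPD\<close> with \<open>T A\<^sub>1 T = A\<^sub>2\<close>. Then \<open>A\<^sub>1 T\<close> and \<open>T A\<^sub>1\<close> are the
  positive square roots of \<open>A\<^sub>1 A\<^sub>2\<close> and \<open>A\<^sub>2 A\<^sub>1\<close>, so \<open>\<gamma>(t) = N A\<^sub>1 N\<close> for \<open>N = 1 + t K\<close>, \<open>K = T - 1\<close>.
  The geodesic equation reads \<open>\<gamma>'' = 2 G \<gamma> G\<close> with \<open>G = \<Gamma>\<^sub>\<gamma>[\<gamma>'] = K N\<^sup>-\<^sup>1\<close>, and the speed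
  \<open>sqrt (tr (G \<gamma> G)) = sqrt (tr (K A\<^sub>1 K))\<close> is constant.

  Minimality is a calibration argument. The matrices \<open>S(\<theta>) = K (1 + \<theta> K)\<^sup>-\<^sup>1\<close> satisfy \<open>S' = - S\<^sup>2\<close>.
  For a competing curve \<open>c\<close> of length \<open>L\<close> take for \<open>\<theta> \<in> [0,1]\<close> its normalised arc length (made
  strictly increasing by an \<open>\<epsilon>\<close>, as the speed may vanish). By the Cauchy-Schwarz inequality
  \<open>tr (S(\<theta>) c)\<close> increases by at most \<open>(L + \<epsilon>)\<^sup>2\<close> along \<open>c\<close>, while its increase is
  \<open>tr (K T\<^sup>-\<^sup>1 A\<^sub>2) - tr (K A\<^sub>1) = tr (K A\<^sub>1 K)\<close>.
\<close>

section \<open>The Lyapunov operator\<close>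

lemma bounded_bilinear_matrix_mult:
  "bounded_bilinear ((**) :: real^'n^'m \<Rightarrow> real^'p^'n \<Rightarrow> real^'p^'m)"
  unfolding bilinear_conv_bounded_bilinear[symmetric] bilinear_def linear_iff
  by (auto simp: matrix_matrix_mult_def vec_eq_iff sum.distrib algebra_simps sum_distrib_left)

interpretation matmul: bounded_bilinear "(**) :: real^'n^'m \<Rightarrow> real^'p^'n \<Rightarrow> real^'p^'m"
  by (rule bounded_bilinear_matrix_mult)

lemmas matmul_simps = matmul.add_left matmul.add_right matmul.diff_left matmul.diff_right
  matmul.minus_left matmul.minus_right matmul.scaleR_left matmul.scaleR_right matrix_mul_assoc

lemma bounded_linear_trace: "bounded_linear (trace :: real^'n^'n \<Rightarrow> real)"
  unfolding linear_conv_bounded_linear[symmetric] linear_iff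
  by (auto simp: trace_def sum.distrib sum_distrib_left)

lemmas linear_trace = bounded_linear.linear[OF bounded_linear_trace]
lemmas trace_simps = linear_0[OF linear_trace] linear_add[OF linear_trace]
  linear_diff[OF linear_trace] linear_neg[OF linear_trace] linear_cmul[OF linear_trace]

lemma bounded_linear_transpose: "bounded_linear (transpose :: real^'n^'m \<Rightarrow> real^'m^'n)"
  unfolding linear_conv_bounded_linear[symmetric] linear_iff
  by (auto simp: transpose_def vec_eq_iff)

lemmas linear_transpose = bounded_linear.linear[OF bounded_linear_transpose]
lemmas transpose_simps = linear_0[OF linear_transpose] linear_add[OF linear_transpose]
  linear_diff[OF linear_transpose] linear_neg[OF linear_transpose]
  linear_cmul[OF linear_transpose] matrix_transpose_mul

lemma trace_transpose: "trace (transpose A) = trace A"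
  by (simp add: trace_def transpose_def)

lemma inner_symmetric_matrix:
  fixes A :: "real^'n^'n"
  assumes "transpose A = A"
  shows "x \<bullet> (A *v y) = (A *v x) \<bullet> y"
  by (metis assms dot_lmul_matrix transpose_matrix_vector)

lemma SymD: "A \<in> Sym \<Longrightarrow> transpose A = A"
  by (simp add: Sym_def)

lemma SPD_imp_Sym: "A \<in> SPD \<Longrightarrow> A \<in> Sym"
  by (simp add: SPD_def)

lemma SPD_transpose: "A \<in> SPD \<Longrightarrow> transpose A = A"
  by (simp add: SPD_def Sym_def)

lemma SPD_pos: "A \<in> SPD \<Longrightarrow> x \<noteq> 0 \<Longrightarrow> 0 < x \<bullet> (A *v x)"
  by (simp add: SPD_def)

lemma SPD_nonneg: "A \<in> SPD \<Longrightarrow> 0 \<le> x \<bullet> (A *v x)"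
  using SPD_pos[of A x] by (cases "x = 0") auto

lemma subspace_Sym: "subspace (Sym :: (real^'n^'n) set)"
  by (auto simp: subspace_def Sym_def transpose_simps)

text \<open>The trace becomes a sum of values of the quadratic form of \<open>A\<close>, so positive
  definiteness turns into trace inequalities.\<close>

lemma trace_congruence:
  fixes A G :: "real^'n^'n"
  shows "trace (transpose G ** A ** G) = (\<Sum>j\<in>UNIV. column j G \<bullet> (A *v column j G))"
proof -
  have "transpose G ** A ** G = transpose G ** (A ** G)"
    by (simp add: matrix_mul_assoc)
  also have "trace \<dots> = (\<Sum>j\<in>UNIV. column j G \<bullet> (A *v column j G))"
    by (simp add: trace_def matrix_matrix_mult_def transpose_def column_def inner_vec_def
        matrix_vector_mult_def)
  finally show ?thesis .
qed

lemma trace_congruence_nonneg: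
  fixes A G :: "real^'n^'n"
  assumes "A \<in> SPD"
  shows "0 \<le> trace (transpose G ** A ** G)"
  unfolding trace_congruence by (intro sum_nonneg SPD_nonneg assms)

lemma trace_congruence_pos:
  fixes A G :: "real^'n^'n"
  assumes "A \<in> SPD" "G \<noteq> 0"
  shows "0 < trace (transpose G ** A ** G)"
proof -
  obtain i j where "G $ i $ j \<noteq> 0"
    using assms(2) by (auto simp: vec_eq_iff)
  then have "column j G \<noteq> 0"
    by (auto simp: column_def vec_eq_iff)
  then show ?thesis
    unfolding trace_congruence using assms(1)
    by (intro sum_pos2[of _ j]) (auto intro: SPD_pos SPD_nonneg)
qed

text \<open>Pairing the equation with \<open>transpose G\<close> under the trace gives the
  congruence traces of \<open>G\<close> and of \<open>transpose G\<close>. Both are nonnegative, and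
  the first is positive unless \<open>G = 0\<close>.\<close>

lemma lyapunov_kernel:
  fixes A G :: "real^'n^'n"
  assumes A: "A \<in> SPD" and eq: "A ** G + G ** A = 0"
  shows "G = 0"
proof (rule ccontr)
  assume "G \<noteq> 0"
  have "0 = trace (transpose G ** (A ** G + G ** A))"
    by (simp add: eq trace_simps)
  also have "\<dots> = trace (transpose G ** A ** G) + trace (transpose G ** (G ** A))"
    by (simp add: matmul_simps trace_simps)
  also have "trace (transpose G ** (G ** A)) = trace (G ** A ** transpose G)"
    by (rule trace_mul_sym)
  finally show False
    using trace_congruence_pos[OF A \<open>G \<noteq> 0\<close>] trace_congruence_nonneg[OF A, of "transpose G"]
    unfolding transpose_transpose by linarith
qed

definition lyapunov_op :: "real^'n^'n \<Rightarrow> real^'n^'n \<Rightarrow> real^'n^'n" where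
  "lyapunov_op A G = A ** G + G ** A"

lemma linear_lyapunov_op: "linear (lyapunov_op A)"
  by (rule linearI) (simp_all add: lyapunov_op_def matmul_simps scaleR_add_right)

lemma inj_lyapunov_op:
  assumes "A \<in> SPD"
  shows "inj (lyapunov_op A)"
  unfolding linear_injective_0[OF linear_lyapunov_op]
  unfolding lyapunov_op_def using lyapunov_kernel[OF assms] by blast

text \<open>Injectivity is assumed instead of \<open>A \<in> SPD\<close>, because differentiating
  the metric needs Lyapunov solutions at \<open>A + s *\<^sub>R Z\<close>. For small
  \<open>s\<close> the operator there is shown to be injective, without showing that the point lies
  in \<open>SPD\<close>.\<close>

lemma lyapunov_unique:
  assumes "inj (lyapunov_op A)" "A ** G + G ** A = X"
  shows "lyapunov A X = G"
  unfolding lyapunov_def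
proof (rule the_equality)
  show "G' = G" if "A ** G' + G' ** A = X" for G'
    by (rule injD[OF assms(1)]) (simp only: lyapunov_op_def assms(2) that)
qed (rule assms(2))

lemma lyapunov_solves_inj:
  assumes "inj (lyapunov_op A)"
  shows "A ** lyapunov A X + lyapunov A X ** A = X"
proof -
  have "surj (lyapunov_op A)"
    by (rule linear_injective_imp_surjective[OF linear_lyapunov_op assms]) simp
  then obtain G where "X = lyapunov_op A G"
    by (rule surjE)
  then have G: "A ** G + G ** A = X"
    unfolding lyapunov_op_def by (rule sym)
  show ?thesis
    unfolding lyapunov_unique[OF assms G] by (rule G)
qed

lemmas lyapunov_solves = lyapunov_solves_inj[OF inj_lyapunov_op]
lemmas lyapunov_eqI = lyapunov_unique[OF inj_lyapunov_op]

lemma lyapunov_Sym_inj: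
  assumes A: "inj (lyapunov_op A)" "A \<in> Sym" and X: "X \<in> Sym"
  shows "transpose (lyapunov A X) = lyapunov A X"
proof -
  have "A ** transpose (lyapunov A X) + transpose (lyapunov A X) ** A
      = transpose (A ** lyapunov A X + lyapunov A X ** A)"
    unfolding transpose_simps SymD[OF A(2)] by (rule add.commute)
  also have "\<dots> = X"
    unfolding lyapunov_solves_inj[OF A(1)] by (rule SymD[OF X])
  finally show ?thesis
    by (rule lyapunov_unique[OF A(1), symmetric])
qed

lemmas lyapunov_Sym = lyapunov_Sym_inj[OF inj_lyapunov_op SPD_imp_Sym]

lemma linear_lyapunov:
  assumes "A \<in> SPD"
  shows "linear (lyapunov A)"
proof (rule linearI)
  fix X Y
  have "A ** (lyapunov A X + lyapunov A Y) + (lyapunov A X + lyapunov A Y) ** A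
      = (A ** lyapunov A X + lyapunov A X ** A) + (A ** lyapunov A Y + lyapunov A Y ** A)"
    by (simp add: matmul_simps)
  then show "lyapunov A (X + Y) = lyapunov A X + lyapunov A Y"
    unfolding lyapunov_solves[OF assms] by (rule lyapunov_eqI[OF assms])
next
  fix r X
  have "A ** (r *\<^sub>R lyapunov A X) + (r *\<^sub>R lyapunov A X) ** A
      = r *\<^sub>R (A ** lyapunov A X + lyapunov A X ** A)"
    by (simp add: matmul_simps scaleR_add_right)
  then show "lyapunov A (r *\<^sub>R X) = r *\<^sub>R lyapunov A X"
    unfolding lyapunov_solves[OF assms] by (rule lyapunov_eqI[OF assms])
qed

text \<open>An injective linear map in finite dimension is bounded below by some \<open>B\<close>.
  Replacing \<open>A\<close> by \<open>A'\<close> changes the value at \<open>G\<close> by at most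
  \<open>2 * C * norm (A' - A) * norm G\<close>, where \<open>C\<close> bounds matrix
  multiplication; the radius \<open>B / (4 * C)\<close> keeps this within
  \<open>B / 2 * norm G\<close>.\<close>

lemma lyapunov_op_bounded_below:
  fixes A :: "real^'n^'n"
  assumes "A \<in> SPD"
  obtains B \<delta> where "B > 0" "\<delta> > 0"
    "\<And>A' G. norm (A' - A) < \<delta> \<Longrightarrow> B * norm G \<le> norm (lyapunov_op A' G)"
proof -
  obtain B where B: "B > 0" "\<And>G. B * norm G \<le> norm (lyapunov_op A G)"
    by (rule linear_inj_bounded_below_pos[OF linear_lyapunov_op inj_lyapunov_op[OF assms]])
      (rule that)
  obtain C where C: "C > 0"
    "\<And>(P :: real^'n^'n) (Q :: real^'n^'n). norm (P ** Q) \<le> norm P * norm Q * C"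
    using matmul.pos_bounded by blast
  show thesis
  proof
    show "B / 2 > 0" "B / (4 * C) > 0"
      using B C by auto
    fix A' G :: "real^'n^'n"
    assume A': "norm (A' - A) < B / (4 * C)"
    have "lyapunov_op A G = lyapunov_op A' G - ((A' - A) ** G + G ** (A' - A))"
      by (simp add: lyapunov_op_def matmul_simps)
    then have "B * norm G \<le> norm (lyapunov_op A' G - ((A' - A) ** G + G ** (A' - A)))"
      using B(2)[of G] by simp
    also have "\<dots> \<le> norm (lyapunov_op A' G) + norm ((A' - A) ** G + G ** (A' - A))"
      by (rule norm_triangle_ineq4)
    also have "\<dots> \<le> norm (lyapunov_op A' G) + (norm ((A' - A) ** G) + norm (G ** (A' - A)))"
      by (intro add_left_mono norm_triangle_ineq)
    also have "\<dots> \<le> norm (lyapunov_op A' G)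
        + (norm (A' - A) * norm G * C + norm G * norm (A' - A) * C)"
      by (intro add_mono C order_refl)
    also have "\<dots> = norm (lyapunov_op A' G) + (norm (A' - A) * (2 * C)) * norm G"
      by (simp add: algebra_simps)
    also have "\<dots> \<le> norm (lyapunov_op A' G) + (B / 2) * norm G"
      using A' C by (intro add_left_mono mult_right_mono) (auto simp: field_simps)
    finally show "B / 2 * norm G \<le> norm (lyapunov_op A' G)"
      by simp
  qed
qed

lemma eventually_inj_lyapunov_op:
  assumes "A \<in> SPD" "(f \<longlongrightarrow> A) F"
  shows "\<forall>\<^sub>F s in F. inj (lyapunov_op (f s))"
proof -
  obtain B \<delta> where B: "B > 0" "\<delta> > 0"
    "\<And>A' G. norm (A' - A) < \<delta> \<Longrightarrow> B * norm G \<le> norm (lyapunov_op A' G)"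
    by (rule lyapunov_op_bounded_below[OF assms(1)]) (rule that)
  have "\<forall>\<^sub>F s in F. dist (f s) A < \<delta>"
    using assms(2) B(2) by (rule tendstoD)
  then show ?thesis
  proof eventually_elim
    case (elim s)
    then have "G = 0" if "lyapunov_op (f s) G = 0" for G
      using B(3)[of "f s" G] that B(1) by (auto simp: dist_norm mult_le_0_iff)
    then show ?case
      unfolding linear_injective_0[OF linear_lyapunov_op] by blast
  qed
qed

text \<open>The operator at \<open>f s\<close> sends the error
  \<open>lyapunov (f s) (g s) - lyapunov A X\<close> to a residual that tends to zero by continuity
  of multiplication. The lower bound, uniform near \<open>A\<close>, passes this on to the
  error.\<close>

lemma tendsto_lyapunov:
  fixes A :: "real^'n^'n"
  assumes A: "A \<in> SPD" and f: "(f \<longlongrightarrow> A) F" and g: "(g \<longlongrightarrow> X) F"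
  shows "((\<lambda>s. lyapunov (f s) (g s)) \<longlongrightarrow> lyapunov A X) F"
proof -
  obtain B \<delta> where B: "B > 0" "\<delta> > 0"
    "\<And>A' G. norm (A' - A) < \<delta> \<Longrightarrow> B * norm G \<le> norm (lyapunov_op A' G)"
    by (rule lyapunov_op_bounded_below[OF A]) (rule that)
  let ?L = "lyapunov A X"
  have lim: "((\<lambda>s. inverse B * norm (g s - lyapunov_op (f s) ?L)) \<longlongrightarrow>
      inverse B * norm (X - lyapunov_op A ?L)) F"
    unfolding lyapunov_op_def by (intro tendsto_intros matmul.tendsto f g)
  have "X - lyapunov_op A ?L = 0"
    using lyapunov_solves[OF A, of X] by (simp add: lyapunov_op_def)
  then have lim: "((\<lambda>s. inverse B * norm (g s - lyapunov_op (f s) ?L)) \<longlongrightarrow> 0) F"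
    using lim by simp
  have "\<forall>\<^sub>F s in F. dist (f s) A < \<delta>"
    using f B(2) by (rule tendstoD)
  then have "\<forall>\<^sub>F s in F. norm (lyapunov (f s) (g s) - ?L)
      \<le> inverse B * norm (g s - lyapunov_op (f s) ?L)"
    using eventually_inj_lyapunov_op[OF A f]
  proof eventually_elim
    case (elim s)
    have "lyapunov_op (f s) (lyapunov (f s) (g s) - ?L) = g s - lyapunov_op (f s) ?L"
      using lyapunov_solves_inj[OF elim(2), of "g s"]
      by (simp add: linear_diff[OF linear_lyapunov_op]) (simp add: lyapunov_op_def)
    then have "B * norm (lyapunov (f s) (g s) - ?L) \<le> norm (g s - lyapunov_op (f s) ?L)"
      using B(3)[of "f s" "lyapunov (f s) (g s) - ?L"] elim(1) by (simp add: dist_norm)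
    then show ?case
      using B(1) by (simp add: field_simps)
  qed
  then have "((\<lambda>s. lyapunov (f s) (g s) - ?L) \<longlongrightarrow> 0) F"
    using lim by (rule Lim_null_comparison)
  then show ?thesis
    by (rule LIM_zero_cancel)
qed

lemma continuous_on_lyapunov:
  assumes "continuous_on S f" "continuous_on S g" "\<And>s. s \<in> S \<Longrightarrow> f s \<in> SPD"
  shows "continuous_on S (\<lambda>s. lyapunov (f s) (g s))"
  using assms unfolding continuous_on_def by (blast intro: tendsto_lyapunov)

section \<open>Spectral theorem and square roots\<close>

text \<open>The maximum of a quadratic form on the unit sphere of an invariant subspace is attained at an
  eigenvector.\<close>

lemma selfadjoint_eigenvector:
  fixes f :: "'a::euclidean_space \<Rightarrow> 'a"
  assumes f: "linear f" and sym: "\<And>x y. f x \<bullet> y = x \<bullet> f y"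
    and V: "subspace V" "f ` V \<subseteq> V" "V \<noteq> {0}"
  obtains v l where "v \<in> V" "norm v = 1" "f v = l *\<^sub>R v"
proof -
  let ?S = "V \<inter> sphere 0 1"
  obtain u where "u \<in> V" "u \<noteq> 0"
    using V subspace_0 by blast
  then have "u /\<^sub>R norm u \<in> ?S"
    using V(1) by (simp add: subspace_scale)
  moreover have "compact ?S"
    using closed_subspace[OF V(1)] by (intro closed_Int_compact) auto
  moreover have "continuous_on ?S (\<lambda>x. x \<bullet> f x)"
    using f by (intro continuous_intros linear_continuous_on) (simp add: linear_conv_bounded_linear)
  ultimately obtain v where v: "v \<in> ?S" and max: "\<And>x. x \<in> ?S \<Longrightarrow> x \<bullet> f x \<le> v \<bullet> f v"
    using continuous_attains_sup[of ?S "\<lambda>x. x \<bullet> f x"] by blast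
  define l where "l = v \<bullet> f v"
  have le: "x \<bullet> f x \<le> l * (x \<bullet> x)" if "x \<in> V" for x
  proof (cases "x = 0")
    case False
    have "x /\<^sub>R norm x \<in> ?S"
      using that False V(1) by (simp add: subspace_scale)
    from max[OF this] have "(x \<bullet> f x) / (norm x * norm x) \<le> l"
      by (simp add: l_def linear_cmul[OF f] divide_inverse algebra_simps)
    then show ?thesis
      using False by (simp add: divide_le_eq dot_square_norm power2_eq_square)
  qed (simp add: linear_0[OF f])
  define w where "w = f v - l *\<^sub>R v"
  have "w \<in> V"
    using v V by (auto simp: w_def intro!: subspace_diff subspace_scale)
  have vv: "v \<bullet> v = 1"
    using v by (simp add: dot_square_norm)
  \<comment> \<open>Here \<open>w\<close> is the defect of \<open>v\<close> as an eigenvector. The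
    bound \<open>le\<close> is applied at \<open>v + s *\<^sub>R w\<close>, where it is an equality
    for \<open>s = 0\<close>.\<close>
  have *: "2 * s * (w \<bullet> w) \<le> s\<^sup>2 * (l * (w \<bullet> w) - w \<bullet> f w)" for s
  proof -
    have "v + s *\<^sub>R w \<in> V"
      using v V \<open>w \<in> V\<close> by (auto intro!: subspace_add subspace_scale)
    moreover have "v \<bullet> w = w \<bullet> v" "v \<bullet> f w = w \<bullet> f v"
      using sym[of v w] by (simp_all add: inner_commute)
    ultimately have "l + 2 * s * (w \<bullet> f v) + s\<^sup>2 * (w \<bullet> f w)
        \<le> l * (1 + 2 * s * (w \<bullet> v) + s\<^sup>2 * (w \<bullet> w))"
      using le[of "v + s *\<^sub>R w"]
      by (simp add: linear_add[OF f] linear_cmul[OF f] inner_add_left inner_add_right vv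
          l_def[symmetric] power2_eq_square algebra_simps)
    moreover have "w \<bullet> f v = w \<bullet> w + l * (w \<bullet> v)"
      by (simp add: w_def inner_diff_right algebra_simps)
    ultimately show ?thesis
      by (simp add: algebra_simps)
  qed
  have "w \<bullet> w \<le> 0"
  proof (rule ccontr)
    assume "\<not> w \<bullet> w \<le> 0"
    \<comment> \<open>For small positive \<open>s\<close> the linear left side of \<open>*\<close>
      exceeds the quadratic right side. The summand 1 keeps \<open>c\<close> positive, and this
      \<open>s\<close> bounds the right side by \<open>s * (w \<bullet> w)\<close>.\<close>
    define c where "c = \<bar>l * (w \<bullet> w) - w \<bullet> f w\<bar> + 1"
    define s where "s = (w \<bullet> w) / c"
    have "s > 0"
      unfolding s_def c_def using \<open>\<not> w \<bullet> w \<le> 0\<close> by (intro divide_pos_pos) linarith+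
    have "s * (2 * (w \<bullet> w)) \<le> s * (s * (l * (w \<bullet> w) - w \<bullet> f w))"
      using *[of s] by (simp add: power2_eq_square algebra_simps)
    then have "2 * (w \<bullet> w) \<le> s * (l * (w \<bullet> w) - w \<bullet> f w)"
      using \<open>s > 0\<close> by simp
    also have "\<dots> \<le> s * c"
      using \<open>s > 0\<close> by (intro mult_left_mono) (auto simp: c_def)
    also have "\<dots> = w \<bullet> w"
      by (simp add: s_def c_def)
    finally show False
      using \<open>\<not> w \<bullet> w \<le> 0\<close> by simp
  qed
  then have "w = 0"
    using inner_gt_zero_iff[of w] by linarith
  then have "f v = l *\<^sub>R v"
    by (simp add: w_def)
  then show thesis
    using v by (intro that[of v l]) auto
qed

text \<open>Induction on \<open>dim V\<close>: self-adjointness makes the orthogonal complement of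
  an eigenvector within \<open>V\<close> invariant, and that complement has smaller
  dimension.\<close>

lemma selfadjoint_eigenbasis_subspace:
  fixes f :: "'a::euclidean_space \<Rightarrow> 'a"
  assumes f: "linear f" and sym: "\<And>x y. f x \<bullet> y = x \<bullet> f y"
    and V: "subspace V" "f ` V \<subseteq> V"
  shows "\<exists>B l. finite B \<and> pairwise orthogonal B \<and> span B = V \<and>
    (\<forall>b\<in>B. norm b = 1 \<and> f b = l b *\<^sub>R b)"
  using V
proof (induction "dim V" arbitrary: V rule: less_induct)
  case less
  show ?case
  proof (cases "V = {0}")
    case True
    then show ?thesis
      by (intro exI[of _ "{}"]) auto
  next
    case False
    obtain v m where v: "v \<in> V" "norm v = 1" "f v = m *\<^sub>R v"
      using selfadjoint_eigenvector[OF f sym less.prems False] by blast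
    let ?W = "{y \<in> V. orthogonal v y}"
    have W: "subspace ?W"
      using less.prems(1) by (auto simp: subspace_def orthogonal_def inner_add_right)
    have "v \<bullet> f x = m * (v \<bullet> x)" for x
      unfolding sym[symmetric] by (simp add: v(3))
    then have "f ` ?W \<subseteq> ?W"
      using less.prems(2) by (auto simp: orthogonal_def)
    moreover have "v \<notin> ?W"
      using v(2) by (auto simp: orthogonal_def)
    then have "dim ?W < dim V"
      using v(1) W less.prems(1) by (intro dim_psubset) (auto simp: span_eq_iff[THEN iffD2])
    ultimately obtain B l where B: "finite B" "pairwise orthogonal B" "span B = ?W"
      "\<And>b. b \<in> B \<Longrightarrow> norm b = 1 \<and> f b = l b *\<^sub>R b"
      using less.hyps[of ?W] W by blast
    have BW: "B \<subseteq> ?W"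
      using B(3) span_superset by blast
    have "V \<subseteq> span (insert v B)"
    proof
      fix x assume "x \<in> V"
      then have "x - (x \<bullet> v) *\<^sub>R v \<in> ?W"
        using v less.prems(1)
        by (auto simp: orthogonal_def inner_diff_right dot_square_norm inner_commute
            intro!: subspace_diff subspace_scale)
      then show "x \<in> span (insert v B)"
        unfolding B(3)[symmetric] by (auto simp: span_insert)
    qed
    moreover have "span (insert v B) \<subseteq> V"
      using BW v(1) less.prems(1) by (intro span_minimal) auto
    moreover have "pairwise orthogonal (insert v B)"
      using B(2) BW by (auto simp: pairwise_insert orthogonal_commute)
    moreover have "\<forall>b\<in>insert v B. norm b = 1 \<and> f b = (l(v := m)) b *\<^sub>R b"
      using v B(4) \<open>v \<notin> ?W\<close> BW by auto
    ultimately show ?thesis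
      using B(1) by (intro exI[of _ "insert v B"] exI[of _ "l(v := m)"]) auto
  qed
qed

lemma symmetric_matrix_eigenbasis:
  fixes A :: "real^'n^'n"
  assumes "transpose A = A"
  obtains B l where "finite B" "pairwise orthogonal B" "span B = (UNIV :: (real^'n) set)"
    "\<And>b. b \<in> B \<Longrightarrow> norm b = 1" "\<And>b. b \<in> B \<Longrightarrow> A *v b = l b *\<^sub>R b"
proof -
  have "\<exists>B l. finite B \<and> pairwise orthogonal B \<and> span B = (UNIV :: (real^'n) set) \<and>
    (\<forall>b\<in>B. norm b = 1 \<and> A *v b = l b *\<^sub>R b)"
    by (rule selfadjoint_eigenbasis_subspace)
      (auto simp: inner_symmetric_matrix[OF assms])
  then show thesis
    using that by blast
qed

lemma matrix_eq_on_span: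
  fixes A C :: "real^'n^'n"
  assumes "span B = UNIV" "\<And>b. b \<in> B \<Longrightarrow> A *v b = C *v b"
  shows "A = C"
proof -
  have "A *v x = C *v x" for x
    by (rule linear_eq_on_span[of "(*v) A" "(*v) C" B]) (use assms in auto)
  then show ?thesis
    by (simp add: matrix_eq)
qed

lemma matrix_vector_mult_minus_left:
  fixes A :: "real^'n^'m"
  shows "(- A) *v x = - (A *v x)"
  by (simp add: matrix_vector_mult_def vec_eq_iff sum_negf)

text \<open>\<open>R\<close> keeps the eigenbasis of \<open>A\<close> and replaces the eigenvalues
  by their square roots.\<close>

lemma SPD_sqrt:
  fixes A :: "real^'n^'n"
  assumes A: "A \<in> SPD"
  obtains R where "R \<in> SPD" "R ** R = A"
proof -
  obtain B l where B: "finite B" "pairwise orthogonal B" "span B = (UNIV :: (real^'n) set)"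
    "\<And>b. b \<in> B \<Longrightarrow> norm b = 1" "\<And>b. b \<in> B \<Longrightarrow> A *v b = l b *\<^sub>R b"
    by (rule symmetric_matrix_eigenbasis[OF SPD_transpose[OF A]]) (rule that)
  have bb: "b \<bullet> c = (if b = c then 1 else 0)" if "b \<in> B" "c \<in> B" for b c
    using B(2,4) that by (auto simp: pairwise_def orthogonal_def dot_square_norm)
  have l: "l b > 0" if "b \<in> B" for b
  proof -
    have "b \<noteq> 0"
      using B(4)[OF that] by auto
    from SPD_pos[OF A this] show ?thesis
      by (simp add: B(5)[OF that] bb that)
  qed
  define r where "r x = (\<Sum>b\<in>B. (sqrt (l b) * (b \<bullet> x)) *\<^sub>R b)" for x
  have "linear r"
    by (auto simp: linear_iff r_def inner_add_right algebra_simps sum.distrib scaleR_sum_right)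
  define R where "R = matrix r"
  have R: "R *v x = r x" for x
    using \<open>linear r\<close> by (simp add: R_def matrix_works)
  have Rb: "R *v b = sqrt (l b) *\<^sub>R b" if "b \<in> B" for b
  proof -
    have "r b = (\<Sum>c\<in>B. if c = b then sqrt (l b) *\<^sub>R b else 0)"
      unfolding r_def using that by (intro sum.cong) (auto simp: bb)
    then show ?thesis
      using B(1) that by (simp add: R)
  qed
  \<comment> \<open>In this diagonal form the symmetry of \<open>R\<close> is visible, and
    positivity follows since a nonzero \<open>x\<close> cannot be orthogonal to every member of
    \<open>B\<close>.\<close>
  have R_inner: "x \<bullet> (R *v y) = (\<Sum>b\<in>B. sqrt (l b) * ((b \<bullet> x) * (b \<bullet> y)))" for x y
    by (simp add: R r_def inner_sum_right inner_commute[of x] mult_ac)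
  have "R ** R = A"
    using B(3)
  proof (rule matrix_eq_on_span)
    fix b assume b: "b \<in> B"
    show "(R ** R) *v b = A *v b"
      using l[OF b]
      by (simp add: matrix_vector_mul_assoc[symmetric] Rb[OF b] B(5)[OF b] matrix_vector_mult_scaleR)
  qed
  moreover have "R \<in> SPD"
    unfolding SPD_def
  proof (intro CollectI conjI allI impI)
    have "x \<bullet> (R *v y) = x \<bullet> (transpose R *v y)" for x y
    proof -
      have "x \<bullet> (R *v y) = y \<bullet> (R *v x)"
        unfolding R_inner by (simp only: mult.commute)
      also have "\<dots> = (R *v x) \<bullet> y"
        by (rule inner_commute)
      also have "\<dots> = x \<bullet> (transpose R *v y)"
        by (simp only: dot_lmul_matrix[symmetric] vector_transpose_matrix)
      finally show ?thesis .
    qed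
    then have "R *v y = transpose R *v y" for y
      using vector_eq_ldot[of "R *v y" "transpose R *v y"] by blast
    then have "R = transpose R"
      unfolding matrix_eq by blast
    then show "R \<in> Sym"
      unfolding Sym_def by (simp only: mem_Collect_eq)
  next
    fix x :: "real^'n"
    assume "x \<noteq> 0"
    have "\<exists>b\<in>B. b \<bullet> x \<noteq> 0"
    proof (rule ccontr)
      assume "\<not> ?thesis"
      then have "orthogonal x y" if "y \<in> span B" for y
        using that by (intro orthogonal_to_span[of y B x]) (auto simp: orthogonal_def inner_commute)
      then have "orthogonal x x"
        unfolding B(3) by blast
      then show False
        using \<open>x \<noteq> 0\<close> by (simp add: orthogonal_self)
    qed
    then obtain b where "b \<in> B" "b \<bullet> x \<noteq> 0"
      by blast
    then show "0 < x \<bullet> (R *v x)"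
      unfolding R_inner using B(1) l
      by (intro sum_pos2[of B b])
        (auto intro!: mult_pos_pos mult_nonneg_nonneg[OF _ zero_le_square]
          simp: less_imp_le zero_less_mult_iff linorder_neq_iff)
  qed
  ultimately show thesis
    using that by blast
qed

lemma SPD_inverse:
  fixes A :: "real^'n^'n"
  assumes A: "A \<in> SPD"
  obtains A' where "A' \<in> SPD" "A ** A' = mat 1" "A' ** A = mat 1"
proof -
  have "\<exists>C. C ** A = mat 1"
    unfolding matrix_left_invertible_ker using SPD_pos[OF A] by fastforce
  then obtain A' where A': "A' ** A = mat 1" "A ** A' = mat 1"
    by (auto simp: matrix_left_right_inverse)
  have "A ** transpose A' = transpose (A' ** A)"
    by (simp add: transpose_simps SPD_transpose[OF A])
  then have "A ** transpose A' = mat 1"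
    by (simp add: A')
  then have "transpose A' = A'"
    by (metis A'(1) matrix_mul_assoc matrix_mul_lid matrix_mul_rid)
  moreover have "0 < x \<bullet> (A' *v x)" if "x \<noteq> 0" for x
  proof -
    have x: "x = A *v (A' *v x)"
      by (simp add: matrix_vector_mul_assoc A')
    then have "A' *v x \<noteq> 0"
      using that by (metis matrix_vector_mult_0_right)
    from SPD_pos[OF A this] show ?thesis
      using x by (simp add: inner_commute)
  qed
  ultimately have "A' \<in> SPD"
    by (simp add: SPD_def Sym_def)
  then show thesis
    using that A' by blast
qed

lemma SPD_congruence:
  fixes A N :: "real^'n^'n"
  assumes A: "A \<in> SPD" and N: "N \<in> SPD"
  shows "N ** A ** N \<in> SPD"
  unfolding SPD_def Sym_def
proof (intro CollectI conjI allI impI)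
  show "transpose (N ** A ** N) = N ** A ** N"
    by (simp add: transpose_simps SPD_transpose[OF A] SPD_transpose[OF N] matrix_mul_assoc)
  fix x :: "real^'n"
  assume "x \<noteq> 0"
  then have "N *v x \<noteq> 0"
    using SPD_pos[OF N] by force
  from SPD_pos[OF A this] show "0 < x \<bullet> ((N ** A ** N) *v x)"
    by (simp add: matrix_vector_mul_assoc[symmetric] inner_symmetric_matrix[OF SPD_transpose[OF N]])
qed

text \<open>The witness is \<open>A^(-1/2) (A^(1/2) B A^(1/2))^(1/2) A^(-1/2)\<close>, the linear
  optimal transport map between centred Gaussians with covariances \<open>A\<close> and
  \<open>B\<close>.\<close>

lemma SPD_transport_exists:
  fixes A B :: "real^'n^'n"
  assumes A: "A \<in> SPD" and B: "B \<in> SPD"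
  obtains T where "T \<in> SPD" "T ** A ** T = B"
proof -
  obtain R where R: "R \<in> SPD" "R ** R = A"
    using SPD_sqrt[OF A] .
  obtain R' where R': "R' \<in> SPD" "R ** R' = mat 1" "R' ** R = mat 1"
    using SPD_inverse[OF R(1)] .
  obtain Q where Q: "Q \<in> SPD" "Q ** Q = R ** B ** R"
    using SPD_sqrt[OF SPD_congruence[OF B R(1)]] .
  have "R' ** Q ** R' ** A ** (R' ** Q ** R') = R' ** Q ** (R' ** R) ** (R ** R') ** Q ** R'"
    by (simp add: R(2)[symmetric] matrix_mul_assoc)
  also have "\<dots> = R' ** (Q ** Q) ** R'"
    by (simp add: R' matrix_mul_assoc)
  also have "\<dots> = (R' ** R) ** B ** (R ** R')"
    by (simp add: Q matrix_mul_assoc)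
  finally have "R' ** Q ** R' ** A ** (R' ** Q ** R') = B"
    by (simp add: R')
  then show thesis
    using that SPD_congruence[OF Q(1) R'(1)] by blast
qed

section \<open>Spectrum of products of positive definite matrices\<close>

lemma map_matrix_of_real_mult_vec:
  fixes M :: "real^'n^'n" and v :: "complex^'n"
  shows "Re ((map_matrix complex_of_real M *v v) $ i) = (M *v (\<chi> j. Re (v $ j))) $ i"
    and "Im ((map_matrix complex_of_real M *v v) $ i) = (M *v (\<chi> j. Im (v $ j))) $ i"
  by (simp_all add: matrix_vector_mult_def)

lemma eigenvalue_real_imaginary_parts:
  fixes M :: "real^'n^'n"
  assumes "eigenvalue M l"
  obtains x y where "x \<noteq> 0 \<or> y \<noteq> 0"
    "M *v x = Re l *\<^sub>R x - Im l *\<^sub>R y" "M *v y = Im l *\<^sub>R x + Re l *\<^sub>R y"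
proof -
  obtain v where v: "v \<noteq> 0" "map_matrix complex_of_real M *v v = l *s v"
    using assms by (auto simp: eigenvalue_def)
  let ?x = "\<chi> j. Re (v $ j)" and ?y = "\<chi> j. Im (v $ j)"
  have "?x \<noteq> 0 \<or> ?y \<noteq> 0"
    using v(1) by (auto simp: vec_eq_iff complex_eq_iff)
  moreover have "M *v ?x = Re l *\<^sub>R ?x - Im l *\<^sub>R ?y" "M *v ?y = Im l *\<^sub>R ?x + Re l *\<^sub>R ?y"
    using v(2) by (simp_all add: vec_eq_iff map_matrix_of_real_mult_vec[symmetric] algebra_simps)
  ultimately show thesis
    using that by blast
qed

lemma eigenvalue_of_real:
  fixes M :: "real^'n^'n"
  assumes "M *v x = l *\<^sub>R x" "x \<noteq> 0"
  shows "eigenvalue M (complex_of_real l)"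
  unfolding eigenvalue_def
proof (intro exI conjI)
  let ?v = "(\<chi> i. complex_of_real (x $ i)) :: complex^'n"
  show "?v \<noteq> 0"
    using assms(2) by (auto simp: vec_eq_iff)
  show "map_matrix complex_of_real M *v ?v = complex_of_real l *s ?v"
    using assms(1) by (simp add: vec_eq_iff complex_eq_iff map_matrix_of_real_mult_vec
        zero_vec_def[symmetric])
qed

text \<open>For a complex eigenvector \<open>v = x + i y\<close>, applying \<open>Q\<close> and
  pairing with \<open>v\<close> gives \<open>v* Q P Q v = l (v* Q v)\<close>, where both Hermitian
  forms are positive. The proof uses real bilinear forms: \<open>q\<close> belongs to
  \<open>Q\<close> and \<open>p\<close> to \<open>Q P Q\<close>.\<close>

lemma eigenvalue_SPD_product:
  fixes P Q :: "real^'n^'n"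
  assumes P: "P \<in> SPD" and Q: "Q \<in> SPD" and l: "eigenvalue (P ** Q) l"
  shows "l \<in> \<real> \<and> 0 < Re l"
proof -
  obtain x y where xy: "x \<noteq> 0 \<or> y \<noteq> 0"
    and x: "(P ** Q) *v x = Re l *\<^sub>R x - Im l *\<^sub>R y"
    and y: "(P ** Q) *v y = Im l *\<^sub>R x + Re l *\<^sub>R y"
    using eigenvalue_real_imaginary_parts[OF l] .
  define q where "q u v = u \<bullet> (Q *v v)" for u v
  define p where "p u v = (Q *v u) \<bullet> (P *v (Q *v v))" for u v
  have q_sym: "q u v = q v u" for u v
    unfolding q_def inner_symmetric_matrix[OF SPD_transpose[OF Q], of u] by (rule inner_commute)
  have p_sym: "p u v = p v u" for u v
    unfolding p_def inner_symmetric_matrix[OF SPD_transpose[OF P], of "Q *v u"]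
    by (rule inner_commute)
  have p: "p u v = (Q *v u) \<bullet> ((P ** Q) *v v)" for u v
    by (simp add: p_def matrix_vector_mul_assoc)
  have px: "p u x = Re l * q u x - Im l * q u y" and py: "p u y = Im l * q u x + Re l * q u y" for u
    using inner_symmetric_matrix[OF SPD_transpose[OF Q], of u]
    by (simp_all add: p x y q_def inner_diff_right inner_add_right)
  have Qx: "Q *v u \<noteq> 0" if "u \<noteq> 0" for u
    using SPD_pos[OF Q that] by force
  have pos: "q u u > 0 \<and> p u u > 0" if "u \<noteq> 0" for u
    using SPD_pos[OF Q that] SPD_pos[OF P Qx[OF that]] by (simp add: q_def p_def)
  have nonneg: "q u u \<ge> 0 \<and> p u u \<ge> 0" for u
    by (simp add: q_def p_def SPD_nonneg P Q)
  have q_pos: "q x x + q y y > 0" and p_pos: "p x x + p y y > 0"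
    using xy pos[of x] pos[of y] nonneg[of x] nonneg[of y] by fastforce+
  have "p x x + p y y = Re l * (q x x + q y y)"
    using px[of x] py[of y] q_sym[of x y] by (simp add: algebra_simps)
  then have "0 < Re l"
    using q_pos p_pos by (metis zero_less_mult_pos2)
  \<comment> \<open>The symmetry of \<open>p\<close> equates the formulas for \<open>p x y\<close>
    and \<open>p y x\<close>; the terms with \<open>Re l\<close> cancel.\<close>
  moreover have "Im l * (q x x + q y y) = 0"
    using px[of y] py[of x] q_sym[of x y] p_sym[of x y] by (simp add: algebra_simps)
  then have "Im l = 0"
    using q_pos by simp
  ultimately show ?thesis
    by (simp add: complex_is_Real_iff)
qed

text \<open>With \<open>Q = R ** R\<close>, the product \<open>P ** Q\<close> is similar to the
  symmetric positive definite matrix \<open>R ** P ** R\<close>: the inverse \<open>R'\<close> of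
  \<open>R\<close> carries eigenvectors of the latter to eigenvectors of the former with the same
  eigenvalue.\<close>

lemma SPD_product_eigenbasis:
  fixes P Q :: "real^'n^'n"
  assumes P: "P \<in> SPD" and Q: "Q \<in> SPD"
  obtains B l where "span B = (UNIV :: (real^'n) set)"
    "\<And>b. b \<in> B \<Longrightarrow> 0 < l b \<and> (P ** Q) *v b = l b *\<^sub>R b"
proof -
  obtain R where R: "R \<in> SPD" "R ** R = Q"
    using SPD_sqrt[OF Q] .
  obtain R' where R': "R' \<in> SPD" "R ** R' = mat 1" "R' ** R = mat 1"
    using SPD_inverse[OF R(1)] .
  obtain B l where B: "span B = (UNIV :: (real^'n) set)"
    "\<And>b. b \<in> B \<Longrightarrow> norm b = 1" "\<And>b. b \<in> B \<Longrightarrow> (R ** P ** R) *v b = l b *\<^sub>R b"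
    by (rule symmetric_matrix_eigenbasis[OF SPD_transpose[OF SPD_congruence[OF P R(1)]]]) (rule that)
  have l: "0 < l b" if "b \<in> B" for b
  proof -
    have "b \<noteq> 0"
      using B(2)[OF that] by auto
    from SPD_pos[OF SPD_congruence[OF P R(1)] this] show ?thesis
      using B(2)[OF that] by (simp add: B(3)[OF that] dot_square_norm)
  qed
  have eig: "(P ** Q) *v (R' *v b) = l b *\<^sub>R (R' *v b)" if "b \<in> B" for b
  proof -
    have "P ** Q ** R' = R' ** R ** P ** R ** (R ** R')"
      by (simp add: R(2)[symmetric] R'(3) matrix_mul_assoc)
    also have "\<dots> = R' ** (R ** P ** R)"
      by (simp add: R' matrix_mul_assoc)
    finally have "(P ** Q) *v (R' *v b) = R' *v ((R ** P ** R) *v b)"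
      by (simp only: matrix_vector_mul_assoc)
    also have "\<dots> = l b *\<^sub>R (R' *v b)"
      by (simp only: B(3)[OF that] matrix_vector_mult_scaleR)
    finally show ?thesis .
  qed
  have RR': "R' *v (R *v x) = x" "R *v (R' *v x) = x" for x
    by (simp_all add: matrix_vector_mul_assoc R')
  have "span ((*v) R' ` B) = range ((*v) R')"
    unfolding span_linear_image[OF matrix_vector_mul_linear] B(1) ..
  also have "\<dots> = UNIV"
    by (rule surjI) (rule RR'(1))
  \<comment> \<open>A new basis vector has the form \<open>R' *v b\<close>, so \<open>R\<close>
    recovers the \<open>b\<close> whose eigenvalue it inherits.\<close>
  finally show thesis
    using l by (intro that[of "(*v) R' ` B" "\<lambda>b. l (R *v b)"]) (auto simp: RR' eig)
qed

text \<open>Uniqueness: if \<open>S\<^sup>2 = R\<^sup>2\<close> then \<open>X = S - R\<close> satisfies the Sylvester equation \<open>S X + X R = 0\<close>, so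
  \<open>X\<close> maps an eigenvector of \<open>R\<close> to zero or to an eigenvector of \<open>S\<close> with the opposite eigenvalue.\<close>

lemma positive_sqrt_SPD_product:
  fixes P Q :: "real^'n^'n"
  assumes P: "P \<in> SPD" and Q: "Q \<in> SPD"
  shows "positive_sqrt (P ** Q ** P ** Q) = P ** Q"
  unfolding positive_sqrt_def
proof (rule the_equality)
  show "P ** Q ** (P ** Q) = P ** Q ** P ** Q \<and>
    (\<forall>l. eigenvalue (P ** Q) l \<longrightarrow> l \<in> \<real> \<and> 0 < Re l)"
    using eigenvalue_SPD_product[OF P Q] by (auto simp: matrix_mul_assoc)
next
  fix S
  assume S: "S ** S = P ** Q ** P ** Q \<and> (\<forall>l. eigenvalue S l \<longrightarrow> l \<in> \<real> \<and> 0 < Re l)"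
  let ?R = "P ** Q"
  let ?X = "S - ?R"
  have SX: "S ** ?X = - (?X ** ?R)"
    using S by (simp add: matmul_simps)
  obtain B l where B: "span B = (UNIV :: (real^'n) set)"
    "\<And>b. b \<in> B \<Longrightarrow> 0 < l b \<and> ?R *v b = l b *\<^sub>R b"
    by (rule SPD_product_eigenbasis[OF P Q]) (rule that)
  have "?X = 0"
    using B(1)
  proof (rule matrix_eq_on_span)
    fix b assume b: "b \<in> B"
    have "S *v (?X *v b) = - (?X ** ?R) *v b"
      by (simp only: matrix_vector_mul_assoc SX)
    also have "\<dots> = - ((?X ** ?R) *v b)"
      by (rule matrix_vector_mult_minus_left)
    also have "\<dots> = - (?X *v (?R *v b))"
      by (simp only: matrix_vector_mul_assoc)
    also have "\<dots> = (- l b) *\<^sub>R (?X *v b)"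
      using B(2)[OF b] by (simp add: matrix_vector_mult_scaleR)
    finally have "S *v (?X *v b) = (- l b) *\<^sub>R (?X *v b)" .
    then have "0 < - l b" if "?X *v b \<noteq> 0"
      using eigenvalue_of_real[OF _ that] S by fastforce
    then have "?X *v b = 0"
      using B(2)[OF b] by fastforce
    then show "?X *v b = 0 *v b"
      unfolding matrix_vector_mult_0 .
  qed
  then show "S = ?R"
    by simp
qed

section \<open>Christoffel symbols of the Wasserstein metric\<close>

text \<open>\<open>lyapunov A\<close> inverts \<open>lyapunov_op A\<close>, which is self-adjoint
  for the pairing \<open>trace (U ** V)\<close> by cyclicity of the trace.\<close>

lemma trace_lyapunov_adjoint:
  fixes A X W :: "real^'n^'n"
  assumes "A \<in> SPD"
  shows "trace (lyapunov A W ** X) = trace (W ** lyapunov A X)"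
proof -
  let ?G = "lyapunov A X" and ?H = "lyapunov A W"
  have "trace (?H ** X) = trace (?H ** (A ** ?G + ?G ** A))"
    by (simp only: lyapunov_solves[OF assms])
  also have "\<dots> = trace (?H ** A ** ?G) + trace (?H ** ?G ** A)"
    by (simp only: matmul_simps trace_simps)
  also have "trace (?H ** ?G ** A) = trace (A ** ?H ** ?G)"
    by (simp only: trace_mul_sym[of "?H ** ?G"] matrix_mul_assoc)
  also have "trace (?H ** A ** ?G) + \<dots> = trace ((A ** ?H + ?H ** A) ** ?G)"
    by (simp only: matmul_simps trace_simps add.commute)
  finally show ?thesis
    by (simp only: lyapunov_solves[OF assms])
qed

text \<open>Substituting the Lyapunov equation for \<open>X\<close> gives two traces that
  transposition shows to be equal. The halved form contains a single Lyapunov solution, which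
  simplifies differentiation in \<open>A\<close>.\<close>

lemma wasserstein_metric_eq_half_inj:
  fixes A X Y :: "real^'n^'n"
  assumes A: "inj (lyapunov_op A)" "A \<in> Sym" and X: "X \<in> Sym" and Y: "Y \<in> Sym"
  shows "wasserstein_metric A X Y = trace (lyapunov A Y ** X) / 2"
proof -
  let ?G = "lyapunov A X" and ?H = "lyapunov A Y"
  have "trace (?H ** X) = trace (?H ** (A ** ?G + ?G ** A))"
    by (simp only: lyapunov_solves_inj[OF A(1)])
  also have "\<dots> = trace (?H ** A ** ?G) + trace (?H ** ?G ** A)"
    by (simp only: matmul_simps trace_simps)
  also have "trace (?H ** ?G ** A) = trace (transpose (?H ** ?G ** A))"
    by (rule trace_transpose[symmetric])
  also have "\<dots> = trace (A ** ?G ** ?H)"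
    by (simp only: transpose_simps SymD[OF A(2)] lyapunov_Sym_inj[OF A X]
        lyapunov_Sym_inj[OF A Y] matrix_mul_assoc)
  also have "\<dots> = trace (?H ** A ** ?G)"
    by (simp only: trace_mul_sym[of "A ** ?G"] matrix_mul_assoc)
  finally show ?thesis
    by (simp add: wasserstein_metric_def)
qed

lemmas wasserstein_metric_eq_half = wasserstein_metric_eq_half_inj[OF inj_lyapunov_op SPD_imp_Sym]

text \<open>Subtracting the Lyapunov equations at \<open>A + s *\<^sub>R Z\<close> and at
  \<open>A\<close> yields the exact identity \<open>G_diff\<close>. After division by
  \<open>s\<close>, continuity of the Lyapunov solution gives the limit.\<close>

lemma metric_deriv_wasserstein:
  fixes A X Y Z :: "real^'n^'n"
  assumes A: "A \<in> SPD" and X: "X \<in> Sym" and Y: "Y \<in> Sym" and Z: "Z \<in> Sym"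
  shows "metric_deriv wasserstein_metric A Z X Y
    = - trace ((Z ** lyapunov A Y + lyapunov A Y ** Z) ** lyapunov A X) / 2"
proof -
  define G where "G s = lyapunov (A + s *\<^sub>R Z) Y" for s :: real
  have lim_A: "((\<lambda>s. A + s *\<^sub>R Z) \<longlongrightarrow> A) (at 0)"
    by (rule tendsto_eq_intros | simp)+
  have lim_G: "(G \<longlongrightarrow> G 0) (at 0)"
    unfolding G_def using tendsto_lyapunov[OF A lim_A tendsto_const] by simp
  have inj: "\<forall>\<^sub>F s in at 0. inj (lyapunov_op (A + s *\<^sub>R Z))"
    by (rule eventually_inj_lyapunov_op[OF A lim_A])
  have Sym: "A + s *\<^sub>R Z \<in> Sym" for s
    using subspace_Sym SPD_imp_Sym[OF A] Z by (intro subspace_add subspace_scale)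
  have G_diff: "G s - G 0 = (- s) *\<^sub>R lyapunov A (Z ** G s + G s ** Z)"
    if "inj (lyapunov_op (A + s *\<^sub>R Z))" for s
  proof -
    have "A ** (G s - G 0) + (G s - G 0) ** A = (- s) *\<^sub>R (Z ** G s + G s ** Z)"
      using lyapunov_solves_inj[OF that, of Y] lyapunov_solves[OF A, of Y]
      by (simp add: G_def matmul_simps algebra_simps)
    from lyapunov_eqI[OF A this] show ?thesis
      by (simp only: linear_cmul[OF linear_lyapunov[OF A]])
  qed
  have "((\<lambda>s. - (trace (lyapunov A (Z ** G s + G s ** Z) ** X) / 2))
      \<longlongrightarrow> - (trace (lyapunov A (Z ** G 0 + G 0 ** Z) ** X) / 2)) (at 0)"
    by (intro tendsto_intros tendsto_lyapunov A matmul.tendsto lim_G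
        bounded_linear.tendsto[OF bounded_linear_trace]) simp
  moreover have "\<forall>\<^sub>F s in at 0. - (trace (lyapunov A (Z ** G s + G s ** Z) ** X) / 2)
      = (wasserstein_metric (A + (0 + s) *\<^sub>R Z) X Y - wasserstein_metric (A + 0 *\<^sub>R Z) X Y) / s"
    using inj eventually_neq_at_within[of 0]
  proof eventually_elim
    case (elim s)
    have "wasserstein_metric (A + s *\<^sub>R Z) X Y - wasserstein_metric A X Y = trace ((G s - G 0) ** X) / 2"
      using wasserstein_metric_eq_half_inj[OF elim(1) Sym X Y] wasserstein_metric_eq_half[OF A A X Y]
      by (simp add: G_def matmul_simps trace_simps diff_divide_distrib)
    also have "\<dots> = - s * (trace (lyapunov A (Z ** G s + G s ** Z) ** X) / 2)"
      by (simp only: G_diff[OF elim(1)] matmul_simps trace_simps) simp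
    finally show ?case
      using elim(2) by simp
  qed
  ultimately have "DERIV (\<lambda>s. wasserstein_metric (A + s *\<^sub>R Z) X Y) 0 :>
      - (trace (lyapunov A (Z ** G 0 + G 0 ** Z) ** X) / 2)"
    unfolding DERIV_def by (rule Lim_transform_eventually)
  then have "metric_deriv wasserstein_metric A Z X Y
      = - (trace (lyapunov A (Z ** G 0 + G 0 ** Z) ** X) / 2)"
    unfolding metric_deriv_def by (rule DERIV_imp_deriv)
  then show ?thesis
    by (simp add: G_def trace_lyapunov_adjoint[OF A])
qed

lemma wasserstein_metric_self:
  assumes "A \<in> SPD" "X \<in> Sym"
  shows "wasserstein_metric A X X = trace (transpose (lyapunov A X) ** A ** lyapunov A X)"
  unfolding wasserstein_metric_def lyapunov_Sym[OF assms(1,1,2)] ..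

lemma wasserstein_metric_nonneg: "A \<in> SPD \<Longrightarrow> X \<in> Sym \<Longrightarrow> 0 \<le> wasserstein_metric A X X"
  by (simp only: wasserstein_metric_self trace_congruence_nonneg)

lemma wasserstein_metric_definite:
  assumes A: "A \<in> SPD" and X: "X \<in> Sym" and "wasserstein_metric A X X = 0"
  shows "X = 0"
proof -
  have "lyapunov A X = 0"
    using trace_congruence_pos[OF A, of "lyapunov A X"] assms(3)
    unfolding wasserstein_metric_self[OF A X] by fastforce
  then show ?thesis
    using lyapunov_solves[OF A, of X] by simp
qed

text \<open>Let \<open>G\<close>, \<open>H\<close> be the Lyapunov solutions for \<open>X\<close>,
  \<open>Z\<close>, and substitute \<open>X = A G + G A\<close>, \<open>Z = A H + H A\<close> in the
  metric derivatives. The traces of \<open>A H G G\<close> and \<open>H A G G\<close> cancel, which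
  leaves \<open>- trace (H G A G)\<close>, the metric of the claimed value against
  \<open>Z\<close>.\<close>

lemma christoffel_wasserstein:
  fixes A X :: "real^'n^'n"
  assumes A: "A \<in> SPD" and X: "X \<in> Sym"
  shows "christoffel Sym wasserstein_metric A X X = - 2 *\<^sub>R (lyapunov A X ** A ** lyapunov A X)"
  unfolding christoffel_def
proof (rule the_equality)
  let ?G = "lyapunov A X"
  let ?W = "- 2 *\<^sub>R (?G ** A ** ?G)"
  let ?rhs = "\<lambda>Z. (metric_deriv wasserstein_metric A X X Z + metric_deriv wasserstein_metric A X X Z
      - metric_deriv wasserstein_metric A Z X X) / 2"
  have W: "?W \<in> Sym"
    unfolding Sym_def
    by (simp add: transpose_simps lyapunov_Sym[OF A A X] SPD_transpose[OF A] matrix_mul_assoc)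
  have eq: "wasserstein_metric A ?W Z = ?rhs Z" if Z: "Z \<in> Sym" for Z
  proof -
    let ?H = "lyapunov A Z"
    have "trace ((X ** ?H + ?H ** X) ** ?G)
        = trace ((A ** ?G + ?G ** A) ** ?H ** ?G) + trace (?H ** (A ** ?G + ?G ** A) ** ?G)"
      by (simp only: matmul_simps trace_simps lyapunov_solves[OF A])
    also have "\<dots> = trace (A ** ?G ** ?H ** ?G) + trace (?G ** A ** ?H ** ?G)
        + trace (?H ** A ** ?G ** ?G) + trace (?H ** ?G ** A ** ?G)"
      by (simp add: matmul_simps trace_simps)
    also have "trace (A ** ?G ** ?H ** ?G) = trace (?H ** ?G ** A ** ?G)"
      using trace_mul_sym[of "A ** ?G" "?H ** ?G"] by (simp only: matrix_mul_assoc)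
    also have "trace (?G ** A ** ?H ** ?G) = trace (A ** ?H ** ?G ** ?G)"
      using trace_mul_sym[of ?G "A ** ?H ** ?G"] by (simp only: matrix_mul_assoc)
    finally have 1: "trace ((X ** ?H + ?H ** X) ** ?G) = trace (?H ** ?G ** A ** ?G)
        + trace (A ** ?H ** ?G ** ?G) + trace (?H ** A ** ?G ** ?G) + trace (?H ** ?G ** A ** ?G)" .
    have "trace ((Z ** ?G + ?G ** Z) ** ?G) = trace (Z ** ?G ** ?G) + trace (?G ** Z ** ?G)"
      by (simp only: matmul_simps trace_simps)
    also have "trace (?G ** Z ** ?G) = trace (Z ** ?G ** ?G)"
      using trace_mul_sym[of ?G "Z ** ?G"] by (simp only: matrix_mul_assoc)
    also have "trace (Z ** ?G ** ?G) = trace ((A ** ?H + ?H ** A) ** ?G ** ?G)"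
      by (simp only: lyapunov_solves[OF A])
    also have "\<dots> = trace (A ** ?H ** ?G ** ?G) + trace (?H ** A ** ?G ** ?G)"
      by (simp only: matmul_simps trace_simps)
    finally have 2: "trace ((Z ** ?G + ?G ** Z) ** ?G)
        = 2 * (trace (A ** ?H ** ?G ** ?G) + trace (?H ** A ** ?G ** ?G))"
      by simp
    have "wasserstein_metric A ?W Z = - trace (?H ** ?G ** A ** ?G)"
      unfolding wasserstein_metric_eq_half[OF A A W Z] by (simp add: matmul_simps trace_simps)
    then show ?thesis
      unfolding metric_deriv_wasserstein[OF A X Z X] metric_deriv_wasserstein[OF A X X Z] 1 2
      by (simp add: field_simps)
  qed
  show "?W \<in> Sym \<and> (\<forall>Z\<in>Sym. wasserstein_metric A ?W Z = ?rhs Z)"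
    using W eq by blast
  fix U
  assume U: "U \<in> Sym \<and> (\<forall>Z\<in>Sym. wasserstein_metric A U Z = ?rhs Z)"
  \<comment> \<open>Uniqueness: testing with the difference \<open>U - ?W\<close> itself gives it
    norm zero, and the metric is definite.\<close>
  have D: "U - ?W \<in> Sym"
    using U W subspace_Sym by (blast intro: subspace_diff)
  have "wasserstein_metric A U (U - ?W) = ?rhs (U - ?W)"
    using U D by blast
  then have "wasserstein_metric A U (U - ?W) = wasserstein_metric A ?W (U - ?W)"
    by (simp only: eq[OF D])
  moreover have "U \<in> Sym"
    using U by blast
  ultimately have "wasserstein_metric A (U - ?W) (U - ?W) = 0"
    unfolding wasserstein_metric_eq_half[OF A A D D] wasserstein_metric_eq_half[OF A A W D]
      wasserstein_metric_eq_half[OF A A \<open>U \<in> Sym\<close> D]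
    by (simp only: matmul.diff_right trace_simps diff_divide_distrib diff_self)
  then show "U = ?W"
    using wasserstein_metric_definite[OF A D] by (simp only: right_minus_eq)
qed

section \<open>The Wasserstein geodesic\<close>

text \<open>Displacement interpolation at time \<open>t\<close> between the identity and the
  transport map \<open>T\<close>.\<close>

definition interpolation :: "real^'n^'n \<Rightarrow> real \<Rightarrow> real^'n^'n" where
  "interpolation T t = mat 1 + t *\<^sub>R (T - mat 1)"

lemma interpolation_SPD:
  fixes T :: "real^'n^'n"
  assumes T: "T \<in> SPD" and t: "t \<in> {0..1}"
  shows "interpolation T t \<in> SPD"
  unfolding SPD_def Sym_def
proof (intro CollectI conjI allI impI)
  show "transpose (interpolation T t) = interpolation T t"
    by (simp add: interpolation_def transpose_simps SPD_transpose[OF T])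
  fix x :: "real^'n"
  assume x: "x \<noteq> 0"
  have "x \<bullet> (interpolation T t *v x) = (1 - t) * (x \<bullet> x) + t * (x \<bullet> (T *v x))"
    by (simp add: interpolation_def matrix_vector_mult_add_rdistrib matrix_vector_mult_diff_rdistrib
        scaleR_matrix_vector_assoc[symmetric] inner_add_right inner_diff_right algebra_simps)
  moreover have "0 < x \<bullet> x" "0 < x \<bullet> (T *v x)"
    using x SPD_pos[OF T x] by simp_all
  \<comment> \<open>At \<open>t = 1\<close> the summand with \<open>x \<bullet> x\<close> vanishes
    and the one with \<open>T\<close> alone is positive, hence the case split.\<close>
  ultimately show "0 < x \<bullet> (interpolation T t *v x)"
    using t by (cases "t = 1") (auto intro: add_pos_nonneg)
qed

text \<open>With \<open>K = T - 1\<close> and \<open>N = interpolation T t\<close> this is \<open>K N\<^sup>-\<^sup>1 = N\<^sup>-\<^sup>1 K\<close>, the value \<open>G\<close> at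
  \<open>\<gamma>(t)\<close> of the Lyapunov operator along the geodesic. Writing it as the solution of
  \<open>N G + G N = 2 K\<close> gives its continuity in \<open>t\<close>.\<close>

definition slope :: "real^'n^'n \<Rightarrow> real \<Rightarrow> real^'n^'n" where
  "slope T t = lyapunov (interpolation T t) (2 *\<^sub>R (T - mat 1))"

lemma slope_mult:
  fixes T :: "real^'n^'n"
  assumes T: "T \<in> SPD" and t: "t \<in> {0..1}"
  shows "interpolation T t ** slope T t = T - mat 1" "slope T t ** interpolation T t = T - mat 1"
    "transpose (slope T t) = slope T t"
proof -
  let ?N = "interpolation T t" and ?K = "T - mat 1"
  have N: "?N \<in> SPD"
    by (rule interpolation_SPD[OF T t])
  obtain N' where N': "N' \<in> SPD" "?N ** N' = mat 1" "N' ** ?N = mat 1"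
    using SPD_inverse[OF N] .
  have comm: "?K ** ?N = ?N ** ?K"
    by (simp only: interpolation_def matmul.add_left matmul.add_right matmul.scaleR_left
        matmul.scaleR_right matrix_mul_lid matrix_mul_rid)
  have "N' ** ?K = N' ** (?K ** ?N) ** N'"
    by (simp only: matrix_mul_assoc[symmetric] N' matrix_mul_rid)
  also have "\<dots> = (N' ** ?N) ** ?K ** N'"
    unfolding comm by (simp only: matrix_mul_assoc)
  finally have K: "N' ** ?K = ?K ** N'"
    by (simp only: N' matrix_mul_lid)
  have left: "?N ** (N' ** ?K) = ?K"
    by (simp only: matrix_mul_assoc N' matrix_mul_lid)
  have right: "(N' ** ?K) ** ?N = ?K"
    unfolding K by (simp only: matrix_mul_assoc[symmetric] N' matrix_mul_rid)
  have slope: "slope T t = N' ** ?K"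
    unfolding slope_def by (rule lyapunov_eqI[OF N]) (simp only: left right scaleR_2)
  show "?N ** slope T t = ?K" "slope T t ** ?N = ?K"
    unfolding slope by (fact left, fact right)
  show "transpose (slope T t) = slope T t"
    unfolding slope_def using SPD_imp_Sym[OF T]
    by (intro lyapunov_Sym N) (simp add: Sym_def transpose_simps)
qed

text \<open>As for resolvents, \<open>slope T s - slope T t = (t - s) *\<^sub>R (slope T s ** slope
  T t)\<close> holds exactly, so continuity of \<open>slope T\<close> gives the derivative. It is
  taken within \<open>{0..1}\<close>, where \<open>interpolation_SPD\<close> provides
  invertibility.\<close>

lemma slope_has_vector_derivative:
  fixes T :: "real^'n^'n"
  assumes T: "T \<in> SPD" and t: "t \<in> {0..1}"
  shows "(slope T has_vector_derivative - (slope T t ** slope T t)) (at t within {0..1})"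
proof -
  let ?K = "T - mat 1"
  have diff: "slope T s - slope T t = (s - t) *\<^sub>R - (slope T s ** slope T t)" if s: "s \<in> {0..1}" for s
  proof -
    have N: "interpolation T s \<in> SPD"
      by (rule interpolation_SPD[OF T s])
    obtain N' where N': "N' \<in> SPD" "interpolation T s ** N' = mat 1" "N' ** interpolation T s = mat 1"
      using SPD_inverse[OF N] .
    have Ns: "interpolation T s = interpolation T t + (s - t) *\<^sub>R ?K"
      by (simp add: interpolation_def algebra_simps)
    have "interpolation T s ** (slope T s - slope T t)
        = ?K - (interpolation T t + (s - t) *\<^sub>R ?K) ** slope T t"
      unfolding Ns[symmetric] by (simp only: matmul.diff_right slope_mult[OF T s])
    also have "\<dots> = (s - t) *\<^sub>R - (?K ** slope T t)"
      by (simp only: matmul.add_left matmul.scaleR_left slope_mult[OF T t]) simp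
    also have "\<dots> = interpolation T s ** ((s - t) *\<^sub>R - (slope T s ** slope T t))"
      by (simp only: matmul_simps slope_mult[OF T s])
    finally have "N' ** interpolation T s ** (slope T s - slope T t)
        = N' ** interpolation T s ** ((s - t) *\<^sub>R - (slope T s ** slope T t))"
      by (simp only: matrix_mul_assoc[symmetric])
    then show ?thesis
      by (simp only: N' matrix_mul_lid)
  qed
  have "(slope T \<longlongrightarrow> slope T t) (at t within {0..1})"
    unfolding slope_def interpolation_def
    using interpolation_SPD[OF T t, unfolded interpolation_def]
    by (intro tendsto_lyapunov tendsto_intros)
  then have "((\<lambda>s. norm (slope T t ** slope T t - slope T s ** slope T t))
      \<longlongrightarrow> norm (slope T t ** slope T t - slope T t ** slope T t)) (at t within {0..1})"
    by (intro tendsto_intros matmul.tendsto)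
  then have "((\<lambda>s. norm (slope T t ** slope T t - slope T s ** slope T t)) \<longlongrightarrow> 0)
      (at t within {0..1})"
    by simp
  moreover have "\<forall>\<^sub>F s in at t within {0..1}.
      norm (slope T t ** slope T t - slope T s ** slope T t)
      = norm (slope T s - slope T t - (s - t) *\<^sub>R - (slope T t ** slope T t)) / norm (s - t)"
    unfolding eventually_at_filter
  proof (intro always_eventually allI impI)
    fix s assume "s \<noteq> t" and s: "s \<in> {0..1}"
    have "slope T s - slope T t - (s - t) *\<^sub>R - (slope T t ** slope T t)
        = (s - t) *\<^sub>R (slope T t ** slope T t - slope T s ** slope T t)"
      unfolding diff[OF s] by (simp add: scaleR_diff_right)
    then show "norm (slope T t ** slope T t - slope T s ** slope T t)
        = norm (slope T s - slope T t - (s - t) *\<^sub>R - (slope T t ** slope T t)) / norm (s - t)"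
      using \<open>s \<noteq> t\<close> by simp
  qed
  ultimately show ?thesis
    unfolding has_vector_derivative_def has_derivative_iff_norm
    by (intro conjI bounded_linear_scaleR_left) (rule Lim_transform_eventually)
qed

lemma interpolation_congruence:
  fixes A T :: "real^'n^'n"
  shows "interpolation T t ** A ** interpolation T t
    = A + t *\<^sub>R ((T - mat 1) ** A + A ** (T - mat 1)) + t\<^sup>2 *\<^sub>R ((T - mat 1) ** A ** (T - mat 1))"
proof -
  let ?K = "T - mat 1"
  have "(mat 1 + t *\<^sub>R ?K) ** A ** (mat 1 + t *\<^sub>R ?K)
      = A + t *\<^sub>R (?K ** A) + (t *\<^sub>R (A ** ?K) + t *\<^sub>R (t *\<^sub>R (?K ** A ** ?K)))"
    by (simp only: matmul.add_left matmul.add_right matmul.scaleR_left matmul.scaleR_right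
        matrix_mul_lid matrix_mul_rid scaleR_add_right matrix_mul_assoc add.assoc)
  then show ?thesis
    by (simp add: interpolation_def power2_eq_square scaleR_add_right)
qed

section \<open>Velocity, acceleration, geodesic equation and length of the curve\<close>

context
  fixes A T :: "real^'n^'n"
  assumes A: "A \<in> SPD" and T: "T \<in> SPD"
begin

private abbreviation "K \<equiv> T - mat 1"
private abbreviation "c \<equiv> \<lambda>t. interpolation T t ** A ** interpolation T t"
private abbreviation "c' \<equiv> \<lambda>t. (K ** A + A ** K) + (2 * t) *\<^sub>R (K ** A ** K)"

lemma wasserstein_geodesic_SPD: "t \<in> {0..1} \<Longrightarrow> c t \<in> SPD"
  by (intro SPD_congruence A interpolation_SPD T)

lemma wasserstein_geodesic_derivative: "(c has_vector_derivative c' t) (at t within S)"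
proof -
  have "((\<lambda>t. A + t *\<^sub>R (K ** A + A ** K) + t\<^sup>2 *\<^sub>R (K ** A ** K)) has_vector_derivative c' t)
      (at t within S)"
    by (rule derivative_eq_intros | simp)+
  then show ?thesis
    unfolding interpolation_congruence .
qed

lemma wasserstein_geodesic_derivative2:
  "(c' has_vector_derivative 2 *\<^sub>R (K ** A ** K)) (at t within S)"
  by (rule derivative_eq_intros | simp)+

lemma wasserstein_geodesic_derivative_Sym: "c' t \<in> Sym"
  unfolding Sym_def mem_Collect_eq
  by (simp only: transpose_simps SPD_transpose[OF A] SPD_transpose[OF T] transpose_mat
      matrix_mul_assoc add.commute)

lemma wasserstein_geodesic_smooth: "smooth_curve a b c"
proof -
  \<comment> \<open>The curve is quadratic in \<open>t\<close>, so the derivatives beyond the second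
    vanish.\<close>
  define D where "D k = (if k = 0 then c else if k = 1 then c'
      else if k = 2 then (\<lambda>t. 2 *\<^sub>R (K ** A ** K)) else (\<lambda>t. 0))" for k :: nat
  have "(D k has_vector_derivative D (Suc k) t) (at t within {a..b})" for k t
  proof -
    consider "k = 0" | "k = 1" | "k = 2" | "k > 2"
      by linarith
    then show ?thesis
      using wasserstein_geodesic_derivative wasserstein_geodesic_derivative2
      by cases (simp_all add: D_def)
  qed
  moreover have "D 0 = c"
    by (simp add: D_def)
  ultimately show ?thesis
    unfolding smooth_curve_def by blast
qed

lemma wasserstein_geodesic_velocity:
  "t \<in> {0..1} \<Longrightarrow> velocity 0 1 c t = c' t"
  unfolding velocity_def
  by (rule vector_derivative_within_closed_interval[OF zero_less_one _ wasserstein_geodesic_derivative])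

lemma wasserstein_geodesic_acceleration:
  assumes "t \<in> {0..1}"
  shows "velocity 0 1 (velocity 0 1 c) t = 2 *\<^sub>R (K ** A ** K)"
  unfolding velocity_def[of 0 1 "velocity 0 1 c"]
proof (rule vector_derivative_within_closed_interval[OF zero_less_one assms])
  show "(velocity 0 1 c has_vector_derivative 2 *\<^sub>R (K ** A ** K)) (at t within {0..1})"
    by (rule has_vector_derivative_transform[OF assms wasserstein_geodesic_velocity
          wasserstein_geodesic_derivative2])
qed

text \<open>The independence of \<open>t\<close> on the right gives the constant speed and matches
  the constant second derivative in the geodesic equation.\<close>

lemma slope_congruence:
  assumes t: "t \<in> {0..1}"
  shows "slope T t ** c t ** slope T t = K ** A ** K"
proof -
  have "slope T t ** c t ** slope T t
      = (slope T t ** interpolation T t) ** A ** (interpolation T t ** slope T t)"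
    by (simp only: matrix_mul_assoc)
  then show ?thesis
    by (simp only: slope_mult[OF T t])
qed

text \<open>By \<open>slope_mult\<close> the two Lyapunov terms collapse to \<open>N A K\<close> and
  \<open>K A N\<close> with \<open>N = interpolation T t\<close>, and their sum expands to
  \<open>c' t\<close>.\<close>

lemma lyapunov_wasserstein_geodesic:
  assumes t: "t \<in> {0..1}"
  shows "lyapunov (c t) (c' t) = slope T t"
proof (rule lyapunov_eqI[OF wasserstein_geodesic_SPD[OF t]])
  let ?N = "interpolation T t"
  have "c t ** slope T t + slope T t ** c t
      = ?N ** A ** (?N ** slope T t) + (slope T t ** ?N) ** A ** ?N"
    by (simp only: matrix_mul_assoc)
  also have "\<dots> = ?N ** A ** K + K ** A ** ?N"
    by (simp only: slope_mult[OF T t])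
  also have "\<dots> = (A ** K + t *\<^sub>R (K ** A ** K)) + (K ** A + t *\<^sub>R (K ** A ** K))"
    unfolding interpolation_def
    by (simp only: matmul.add_left matmul.add_right matmul.scaleR_left matmul.scaleR_right
        matrix_mul_lid matrix_mul_rid)
  also have "\<dots> = c' t"
    by (simp only: mult_2 scaleR_add_left add_ac)
  finally show "c t ** slope T t + slope T t ** c t = c' t" .
qed

lemma geodesic_wasserstein: "geodesic Sym SPD wasserstein_metric 0 1 c"
  unfolding geodesic_def
proof (intro conjI ballI)
  fix t :: real
  assume t: "t \<in> {0..1}"
  show "c t \<in> SPD"
    by (rule wasserstein_geodesic_SPD[OF t])
  show "velocity 0 1 (velocity 0 1 c) t
      + christoffel Sym wasserstein_metric (c t) (velocity 0 1 c t) (velocity 0 1 c t) = 0"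
    unfolding wasserstein_geodesic_acceleration[OF t] wasserstein_geodesic_velocity[OF t]
      christoffel_wasserstein[OF wasserstein_geodesic_SPD[OF t] wasserstein_geodesic_derivative_Sym]
      lyapunov_wasserstein_geodesic[OF t] slope_congruence[OF t]
    by simp
qed (simp_all add: wasserstein_geodesic_smooth)

lemma wasserstein_geodesic_length:
  "riem_length wasserstein_metric 0 1 c = sqrt (trace (K ** A ** K))"
proof -
  have "riem_length wasserstein_metric 0 1 c = integral {0..1} (\<lambda>t::real. sqrt (trace (K ** A ** K)))"
    unfolding riem_length_def
  proof (rule Henstock_Kurzweil_Integration.integral_cong)
    fix t :: real
    assume t: "t \<in> {0..1}"
    show "sqrt (wasserstein_metric (c t) (velocity 0 1 c t) (velocity 0 1 c t))
        = sqrt (trace (K ** A ** K))"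
      unfolding wasserstein_metric_def wasserstein_geodesic_velocity[OF t]
        lyapunov_wasserstein_geodesic[OF t] slope_congruence[OF t] ..
  qed
  then show ?thesis
    by (simp only: integral_const_real measure_lborel_Icc zero_le_one diff_zero scaleR_one)
qed

end

section \<open>Minimality\<close>

text \<open>Transposition fixes the curve, hence also its derivative. Velocities of competing curves
  are thus tangent vectors on which the metric is nonnegative.\<close>

lemma has_vector_derivative_Sym:
  fixes c :: "real \<Rightarrow> real^'n^'n"
  assumes "p < q" "t \<in> {p..q}" and c: "\<And>t. t \<in> {p..q} \<Longrightarrow> c t \<in> Sym"
    and D: "(c has_vector_derivative D) (at t within {p..q})"
  shows "D \<in> Sym"
proof -
  have "((\<lambda>t. transpose (c t)) has_vector_derivative transpose D) (at t within {p..q})"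
    by (rule bounded_linear.has_vector_derivative[OF bounded_linear_transpose D])
  then have "(c has_vector_derivative transpose D) (at t within {p..q})"
    by (rule has_vector_derivative_transform[OF assms(2), rotated]) (simp add: SymD c)
  then have "transpose D = D"
    using vector_derivative_unique_within_closed_interval[of p q t c] assms(1,2) D by simp
  then show ?thesis
    by (simp add: Sym_def)
qed

text \<open>Expand \<open>tr ((w S - k G) A (w S - k G)) \<ge> 0\<close> for \<open>G = lyapunov A X\<close>.\<close>

lemma trace_mult_le_wasserstein:
  fixes A X S :: "real^'n^'n"
  assumes A: "A \<in> SPD" and X: "X \<in> Sym" and S: "transpose S = S"
    and k: "0 < k" and w: "0 < w" "sqrt (wasserstein_metric A X X) \<le> w"
  shows "trace (S ** X) \<le> w / k * trace (S ** A ** S) + k * w"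
proof -
  let ?G = "lyapunov A X"
  have G: "transpose ?G = ?G"
    by (rule lyapunov_Sym[OF A A X])
  have "trace (?G ** A ** S) = trace (transpose (?G ** A ** S))"
    by (rule trace_transpose[symmetric])
  then have GAS: "trace (?G ** A ** S) = trace (S ** A ** ?G)"
    by (simp only: transpose_simps G S SPD_transpose[OF A] matrix_mul_assoc)
  have "trace (S ** X) = trace (S ** (A ** ?G + ?G ** A))"
    by (simp only: lyapunov_solves[OF A])
  also have "\<dots> = trace (S ** A ** ?G) + trace (S ** ?G ** A)"
    by (simp only: matmul_simps trace_simps)
  also have "trace (S ** ?G ** A) = trace (?G ** A ** S)"
    using trace_mul_sym[of S "?G ** A"] by (simp only: matrix_mul_assoc)
  finally have SX: "trace (S ** X) = 2 * trace (S ** A ** ?G)"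
    unfolding GAS by simp
  let ?E = "w *\<^sub>R S - k *\<^sub>R ?G"
  have "0 \<le> trace (transpose ?E ** A ** ?E)"
    by (rule trace_congruence_nonneg[OF A])
  also have "\<dots> = w * (w * trace (S ** A ** S)) - k * (w * trace (S ** X))
      + k * (k * trace (?G ** A ** ?G))"
    by (simp add: transpose_simps G S matmul_simps trace_simps GAS SX algebra_simps)
  also have "trace (?G ** A ** ?G) \<le> w * w"
    using w(2) sqrt_le_D[of "wasserstein_metric A X X" w]
    by (simp add: wasserstein_metric_def power2_eq_square)
  finally have "k * (w * trace (S ** X)) \<le> w * (w * trace (S ** A ** S)) + k * (k * (w * w))"
    using k by simp
  also have "\<dots> = k * (w * (w / k * trace (S ** A ** S) + k * w))"
    using k by (simp add: field_simps)
  finally show ?thesis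
    using k w(1) by simp
qed

text \<open>The calibration along one \<open>C^1\<close> piece. Here \<open>x\<close> is the
  normalised arc length spent before the piece, \<open>k\<close> the normalising constant and
  \<open>L\<close> the length of the piece regularised by \<open>e\<close>; the condition
  \<open>x + L / k \<le> 1\<close> keeps the parameter \<theta> in \<open>{0..1}\<close>.\<close>

lemma C1_piece_bound:
  fixes c D :: "real \<Rightarrow> real^'n^'n"
  assumes T: "T \<in> SPD" and pq: "p < q"
    and c: "\<And>t. t \<in> {p..q} \<Longrightarrow> c t \<in> SPD"
    and D: "\<And>t. t \<in> {p..q} \<Longrightarrow> (c has_vector_derivative D t) (at t within {p..q})"
      "continuous_on {p..q} D"
    and k: "0 < k" and e: "0 < e" and x: "0 \<le> x"
    and L: "L = integral {p..q} (\<lambda>t. sqrt (wasserstein_metric (c t) (D t) (D t))) + e * (q - p)"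
    and le: "x + L / k \<le> 1"
  shows "trace (slope T (x + L / k) ** c q) - trace (slope T x ** c p) \<le> k * L"
proof -
  define w where "w t = sqrt (wasserstein_metric (c t) (D t) (D t)) + e" for t
  define \<theta> where "\<theta> t = x + integral {p..t} w / k" for t
  have c_cont: "continuous_on {p..q} c"
    by (rule continuous_on_vector_derivative) (rule D(1))
  have D_Sym: "D t \<in> Sym" if "t \<in> {p..q}" for t
    using has_vector_derivative_Sym[OF pq that _ D(1)[OF that]] c SPD_imp_Sym by blast
  have v_cont: "continuous_on {p..q} (\<lambda>t. sqrt (wasserstein_metric (c t) (D t) (D t)))"
    unfolding wasserstein_metric_def
    by (intro continuous_on_real_sqrt bounded_linear.continuous_on[OF bounded_linear_trace]
        matmul.continuous_on continuous_on_lyapunov c_cont D(2) c)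
  have w_cont: "continuous_on {p..q} w"
    unfolding w_def by (intro continuous_intros v_cont)
  have w_pos: "0 < w t" if "t \<in> {p..q}" for t
    using wasserstein_metric_nonneg[OF c[OF that] D_Sym[OF that]] e
    by (simp add: w_def add_nonneg_pos)
  have w_int: "w integrable_on {p..t}" if "t \<in> {p..q}" for t
    using that by (intro integrable_continuous_real continuous_on_subset[OF w_cont]) auto
  have L_eq: "integral {p..q} w = L"
    unfolding w_def L using pq
    by (subst integral_add) (auto intro: integrable_continuous_real v_cont)
  have \<theta>_range: "\<theta> t \<in> {0..1}" if t: "t \<in> {p..q}" for t
  proof -
    have "0 \<le> integral {p..t} w"
      using t by (intro integral_nonneg w_int) (auto intro!: less_imp_le[OF w_pos])
    moreover have "integral {p..t} w \<le> integral {p..q} w"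
      using t pq by (intro integral_subset_le w_int) (auto intro!: less_imp_le[OF w_pos])
    ultimately have "0 \<le> integral {p..t} w / k" "integral {p..t} w / k \<le> L / k"
      using k by (simp_all add: L_eq divide_right_mono)
    then show ?thesis
      using x le unfolding \<theta>_def by simp
  qed
  have \<theta>_deriv: "(\<theta> has_real_derivative w t / k) (at t within {p..q})" if "t \<in> {p..q}" for t
    using DERIV_add[OF DERIV_const[of x] DERIV_cdivide[OF integral_has_real_derivative[OF w_cont that], of k]]
    by (simp add: \<theta>_def[abs_def])
  define S where "S t = slope T (\<theta> t)" for t
  have S_deriv: "(S has_vector_derivative (w t / k) *\<^sub>R - (S t ** S t)) (at t within {p..q})"
    if t: "t \<in> {p..q}" for t
  proof -
    have "(slope T has_vector_derivative - (S t ** S t)) (at (\<theta> t) within \<theta> ` {p..q})"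
      unfolding S_def using \<theta>_range
      by (intro has_vector_derivative_within_subset[OF slope_has_vector_derivative[OF T \<theta>_range[OF t]]])
        blast
    from vector_diff_chain_within[OF _ this, of "w t / k"] \<theta>_deriv[OF t] show ?thesis
      unfolding S_def o_def has_real_derivative_iff_has_vector_derivative by blast
  qed
  \<comment> \<open>\<open>F\<close> rises by \<open>k * L\<close> minus the increase of
    \<open>trace (S t ** c t)\<close>, so its monotonicity is the claim. The derivative is
    nonnegative by \<open>trace_mult_le_wasserstein\<close> at \<open>X = D t\<close>.\<close>
  define F where "F t = k * k * \<theta> t - trace (S t ** c t)" for t
  have F_deriv: "(F has_real_derivative k * w t
      - (trace (S t ** D t) - w t / k * trace (S t ** c t ** S t))) (at t within {p..q})"
    if t: "t \<in> {p..q}" for t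
  proof -
    have "((\<lambda>t. trace (S t ** c t)) has_vector_derivative
        trace (S t ** D t + (w t / k) *\<^sub>R - (S t ** S t) ** c t)) (at t within {p..q})"
      by (intro bounded_linear.has_vector_derivative[OF bounded_linear_trace]
          matmul.has_vector_derivative S_deriv D(1) t)
    moreover have "trace ((w t / k) *\<^sub>R - (S t ** S t) ** c t) = - (w t / k * trace (S t ** c t ** S t))"
      using trace_mul_sym[of "S t" "S t ** c t"] by (simp add: matmul_simps trace_simps)
    ultimately have "((\<lambda>t. trace (S t ** c t)) has_real_derivative
        trace (S t ** D t) - w t / k * trace (S t ** c t ** S t)) (at t within {p..q})"
      unfolding has_real_derivative_iff_has_vector_derivative by (simp add: trace_simps)
    moreover have "((\<lambda>t. k * k * \<theta> t) has_real_derivative k * w t) (at t within {p..q})"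
      using DERIV_cmult[OF \<theta>_deriv[OF t], of "k * k"] k by simp
    ultimately show ?thesis
      unfolding F_def[abs_def] by (rule DERIV_diff[rotated])
  qed
  have "F p \<le> F q"
  proof (rule DERIV_nonneg_imp_increasing_open[of p q F])
    show "p \<le> q"
      using pq by simp
    show "continuous_on {p..q} F"
      using F_deriv by (rule DERIV_continuous_on)
    fix t assume t: "p < t" "t < q"
    then have t': "t \<in> {p..q}"
      by simp
    have "transpose (S t) = S t"
      unfolding S_def by (rule slope_mult(3)[OF T \<theta>_range[OF t']])
    then have "trace (S t ** D t) \<le> w t / k * trace (S t ** c t ** S t) + k * w t"
      using w_pos[OF t'] e by (intro trace_mult_le_wasserstein c t' D_Sym k) (simp_all add: w_def)
    then show "\<exists>y. DERIV F t :> y \<and> 0 \<le> y"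
      using F_deriv[OF t'] unfolding at_within_Icc_at[OF t] by (intro exI conjI) auto
  qed
  moreover have "\<theta> p = x" "\<theta> q = x + L / k"
    by (simp_all add: \<theta>_def L_eq)
  ultimately show ?thesis
    using k by (simp add: F_def S_def algebra_simps)
qed

text \<open>\<open>C1_piece_bound\<close> is chained over the breakpoints: each piece starts at the
  parameter reached by the previous one, so the trace increments telescope.\<close>

lemma wasserstein_length_lower_bound:
  fixes A T :: "real^'n^'n"
  assumes A: "A \<in> SPD" and T: "T \<in> SPD" and ab: "a < b"
    and pw: "piecewise_C1_curve a b c" and c: "\<And>t. t \<in> {a..b} \<Longrightarrow> c t \<in> SPD"
    and ends: "c a = A" "c b = T ** A ** T"
  shows "sqrt (trace ((T - mat 1) ** A ** (T - mat 1))) \<le> riem_length wasserstein_metric a b c"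
proof -
  let ?K = "T - mat 1"
  define f where "f t = sqrt (wasserstein_metric (c t) (velocity a b c t) (velocity a b c t))" for t
  obtain m and s :: "nat \<Rightarrow> real" where s: "s 0 = a" "s m = b"
    and piece: "\<And>i. i < m \<Longrightarrow> s i < s (Suc i) \<and> C1_curve (s i) (s (Suc i)) c"
    using pw unfolding piecewise_C1_curve_def by blast
  have s_ge: "i \<le> m \<Longrightarrow> a \<le> s i" for i
    by (induction i) (use s piece in \<open>auto intro: order_trans less_imp_le simp: Suc_le_eq\<close>)
  have s_le: "i \<le> m \<Longrightarrow> s i \<le> b" for i
    by (induction i rule: inc_induct) (use s piece in \<open>auto intro: order_trans less_imp_le\<close>)
  have K0: "slope T 0 = ?K"
    using slope_mult(1)[OF T, of 0] by (simp add: interpolation_def)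
  \<comment> \<open>Integrability of \<open>f\<close> is built up in the same induction. The numbers
    \<open>k\<close> and \<open>e\<close> stay arbitrary and are fixed only after the last
    piece.\<close>
  have main: "f integrable_on {a..s i} \<and> 0 \<le> integral {a..s i} f \<and>
    (\<forall>k e. 0 < k \<longrightarrow> 0 < e \<longrightarrow> integral {a..s i} f + e * (s i - a) \<le> k \<longrightarrow>
      trace (slope T ((integral {a..s i} f + e * (s i - a)) / k) ** c (s i)) - trace (?K ** A)
        \<le> k * (integral {a..s i} f + e * (s i - a)))" if "i \<le> m" for i
    using that
  proof (induction i)
    case 0
    show ?case
      using integrable_on_refl[of f a] by (simp add: s ends K0)
  next
    case (Suc i)
    then have i: "i < m" "i \<le> m" "Suc i \<le> m"
      by auto
    let ?p = "s i" and ?q = "s (Suc i)"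
    have pq: "?p < ?q" and ap: "a \<le> ?p" and qb: "?q \<le> b"
      using piece[OF i(1)] s_ge[OF i(2)] s_le[OF i(3)] by auto
    obtain D where D: "continuous_on {?p..?q} D"
      "\<And>t. t \<in> {?p..?q} \<Longrightarrow> (c has_vector_derivative D t) (at t within {?p..?q})"
      using piece[OF i(1)] unfolding C1_curve_def by blast
    have c': "c t \<in> SPD" if "t \<in> {?p..?q}" for t
      using that ap qb by (intro c) auto
    have D_Sym: "D t \<in> Sym" if "t \<in> {?p..?q}" for t
      using has_vector_derivative_Sym[OF pq that _ D(2)[OF that]] c' SPD_imp_Sym by blast
    define g where "g t = sqrt (wasserstein_metric (c t) (D t) (D t))" for t
    have c_cont: "continuous_on {?p..?q} c"
      by (rule continuous_on_vector_derivative) (rule D(2))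
    have g_cont: "continuous_on {?p..?q} g"
      unfolding g_def wasserstein_metric_def
      by (intro continuous_on_real_sqrt bounded_linear.continuous_on[OF bounded_linear_trace]
          matmul.continuous_on continuous_on_lyapunov c_cont D(1) c')
    have g_int: "(g has_integral integral {?p..?q} g) {?p..?q}"
      using integrable_continuous_real[OF g_cont] by (rule integrable_integral)
    have g_nonneg: "0 \<le> integral {?p..?q} g"
      by (rule integral_nonneg[OF integrable_continuous_real[OF g_cont]])
        (simp add: g_def wasserstein_metric_nonneg c' D_Sym)
    \<comment> \<open>At a breakpoint \<open>velocity a b c\<close> may disagree with the one-sided
      derivative \<open>D\<close>; two points do not affect the integral.\<close>
    have fg: "f t = g t" if t: "t \<in> {?p..?q} - {?p, ?q}" for t
    proof -
      have t': "?p < t" "t < ?q" "t \<in> {?p..?q}" "t \<in> {a..b}"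
        using t ap qb by auto
      have "(c has_vector_derivative D t) (at t)"
        using D(2)[OF t'(3)] unfolding at_within_Icc_at[OF t'(1,2)] .
      then have "(c has_vector_derivative D t) (at t within {a..b})"
        by (rule has_vector_derivative_at_within)
      then have "velocity a b c t = D t"
        unfolding velocity_def by (rule vector_derivative_within_closed_interval[OF ab t'(4)])
      then show ?thesis
        by (simp add: f_def g_def)
    qed
    have f_int: "(f has_integral integral {?p..?q} g) {?p..?q}"
      by (rule has_integral_spike_finite[of "{?p, ?q}", OF _ fg g_int]) simp_all
    have IH: "f integrable_on {a..?p}" "0 \<le> integral {a..?p} f"
      "\<And>k e. 0 < k \<Longrightarrow> 0 < e \<Longrightarrow> integral {a..?p} f + e * (?p - a) \<le> k \<Longrightarrow>
        trace (slope T ((integral {a..?p} f + e * (?p - a)) / k) ** c ?p) - trace (?K ** A)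
          \<le> k * (integral {a..?p} f + e * (?p - a))"
      using Suc.IH[OF i(2)] by blast+
    have f_int': "(f has_integral integral {a..?p} f + integral {?p..?q} g) {a..?q}"
      using has_integral_combine[OF ap less_imp_le[OF pq] integrable_integral[OF IH(1)] f_int] .
    then have eq: "integral {a..?q} f = integral {a..?p} f + integral {?p..?q} g"
      by (rule integral_unique)
    have "trace (slope T ((integral {a..?q} f + e * (?q - a)) / k) ** c ?q) - trace (?K ** A)
        \<le> k * (integral {a..?q} f + e * (?q - a))"
      if k: "0 < k" and e: "0 < e" and le: "integral {a..?q} f + e * (?q - a) \<le> k" for k e
    proof -
      define y where "y = integral {a..?p} f + e * (?p - a)"
      define L where "L = integral {?p..?q} g + e * (?q - ?p)"
      have yL: "integral {a..?q} f + e * (?q - a) = y + L"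
        unfolding eq y_def L_def by (simp add: algebra_simps)
      have "0 \<le> e * (?p - a)" "0 \<le> e * (?q - ?p)"
        using e ap pq by simp_all
      then have "0 \<le> y" "0 \<le> L"
        using IH(2) g_nonneg by (simp_all add: y_def L_def)
      have "trace (slope T (y / k + L / k) ** c ?q) - trace (slope T (y / k) ** c ?p) \<le> k * L"
      proof (rule C1_piece_bound[OF T pq c' D(2) D(1) k e])
        show "0 \<le> y / k"
          using k \<open>0 \<le> y\<close> by simp
        show "L = integral {?p..?q} (\<lambda>t. sqrt (wasserstein_metric (c t) (D t) (D t))) + e * (?q - ?p)"
          by (simp add: L_def g_def[abs_def])
        show "y / k + L / k \<le> 1"
          using le k unfolding yL by (simp add: add_divide_distrib[symmetric])
      qed
      moreover have "trace (slope T (y / k) ** c ?p) - trace (?K ** A) \<le> k * y"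
        unfolding y_def using le \<open>0 \<le> L\<close> unfolding yL by (intro IH(3) k e) (simp add: y_def)
      ultimately show ?thesis
        unfolding yL by (simp add: add_divide_distrib algebra_simps)
    qed
    then show ?case
      using f_int' IH(2) g_nonneg eq by (auto simp: has_integral_integrable)
  qed
  define L where "L = riem_length wasserstein_metric a b c"
  have L: "integral {a..b} f = L"
    by (simp add: L_def riem_length_def f_def[abs_def])
  have "0 \<le> L"
    using main[of m] L s by simp
  \<comment> \<open>\<open>slope T 1\<close> is \<open>K T^(-1)\<close>, so the end value is
    \<open>trace (K A T)\<close>, and its excess over \<open>trace (K A)\<close> is the squared
    length of the geodesic.\<close>
  have KAK: "trace (slope T 1 ** (T ** A ** T)) - trace (?K ** A) = trace (?K ** A ** ?K)"
  proof -
    have "slope T 1 ** (T ** A ** T) = ?K ** A ** T"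
      using slope_mult(2)[OF T, of 1] by (simp add: interpolation_def matrix_mul_assoc)
    then show ?thesis
      by (simp only: matmul.diff_right matrix_mul_rid trace_simps)
  qed
  have "sqrt (trace (?K ** A ** ?K)) \<le> L + e" if "0 < e" for e
  proof -
    \<comment> \<open>Regularising by \<open>d\<close> adds \<open>e\<close> to the total length,
      and with \<open>k = L + e\<close> the parameter reaches exactly 1 at \<open>b\<close>.\<close>
    define d where "d = e / (b - a)"
    have "0 < d" "0 < L + e" "d * (b - a) = e"
      using that ab \<open>0 \<le> L\<close> by (simp_all add: d_def)
    then have "trace (slope T ((L + e) / (L + e)) ** c b) - trace (?K ** A) \<le> (L + e) * (L + e)"
      using main[of m] unfolding s L by (metis order_refl)
    then have "trace (?K ** A ** ?K) \<le> (L + e)\<^sup>2"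
      using \<open>0 < L + e\<close> KAK by (simp add: ends power2_eq_square)
    then show ?thesis
      using \<open>0 < L + e\<close> by (intro real_le_lsqrt) auto
  qed
  then show ?thesis
    unfolding L_def[symmetric] by (rule field_le_epsilon)
qed

section \<open>Attainment of the infimum and the formula with square roots\<close>

lemma smooth_imp_C1_curve:
  assumes "smooth_curve a b c"
  shows "C1_curve a b c"
proof -
  obtain D :: "nat \<Rightarrow> real \<Rightarrow> 'a" where "D 0 = c"
    and D: "\<And>k t. t \<in> {a..b} \<Longrightarrow> (D k has_vector_derivative D (Suc k) t) (at t within {a..b})"
    using assms unfolding smooth_curve_def by blast
  moreover have "continuous_on {a..b} (D (Suc 0))"
    by (rule continuous_on_vector_derivative) (rule D)
  ultimately show ?thesis
    unfolding C1_curve_def by blast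
qed

lemma minimal_geodesic_wasserstein:
  fixes A T :: "real^'n^'n"
  assumes A: "A \<in> SPD" and T: "T \<in> SPD"
  shows "minimal_geodesic Sym SPD wasserstein_metric A (T ** A ** T)
    (\<lambda>t. interpolation T t ** A ** interpolation T t)"
    (is "minimal_geodesic _ _ _ _ _ ?c")
  unfolding minimal_geodesic_def
proof (intro conjI)
  show "geodesic Sym SPD wasserstein_metric 0 1 ?c"
    by (rule geodesic_wasserstein[OF A T])
  show c0: "?c 0 = A" and c1: "?c 1 = T ** A ** T"
    by (simp_all add: interpolation_def)
  have "C1_curve 0 1 ?c"
    by (rule smooth_imp_C1_curve[OF wasserstein_geodesic_smooth[OF A T]])
  then have pw: "piecewise_C1_curve 0 1 ?c"
    unfolding piecewise_C1_curve_def
    by (intro exI[of _ "1::nat"] exI[of _ "\<lambda>i::nat. if i = 0 then 0 else 1::real"]) simp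
  \<comment> \<open>The infimum is a minimum: the curve is itself a competitor, seen as a single
    \<open>C^1\<close> piece, and the lower bound covers all others.\<close>
  have "riem_dist SPD wasserstein_metric A (T ** A ** T) = riem_length wasserstein_metric 0 1 ?c"
    unfolding riem_dist_def
  proof (rule cInf_eq_minimum)
    show "riem_length wasserstein_metric 0 1 ?c \<in> {riem_length wasserstein_metric a b c | a b c.
        a < b \<and> piecewise_C1_curve a b c \<and> (\<forall>t\<in>{a..b}. c t \<in> SPD) \<and> c a = A \<and> c b = T ** A ** T}"
      using pw wasserstein_geodesic_SPD[OF A T] c0 c1 zero_less_one by blast
  next
    fix x
    assume "x \<in> {riem_length wasserstein_metric a b c | a b c.
        a < b \<and> piecewise_C1_curve a b c \<and> (\<forall>t\<in>{a..b}. c t \<in> SPD) \<and> c a = A \<and> c b = T ** A ** T}"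
    then show "riem_length wasserstein_metric 0 1 ?c \<le> x"
      unfolding wasserstein_geodesic_length[OF A T]
      using wasserstein_length_lower_bound[OF A T] by blast
  qed
  then show "riem_length wasserstein_metric 0 1 ?c = riem_dist SPD wasserstein_metric A (T ** A ** T)" ..
qed

text \<open>With \<open>A2 = T A T\<close>, the products \<open>A A2\<close> and \<open>A2 A\<close>
  are the squares of \<open>A T\<close> and \<open>T A\<close>, which are products of two positive
  definite matrices and hence the positive roots.\<close>

lemma interpolation_congruence_positive_sqrt:
  fixes A T :: "real^'n^'n"
  assumes A: "A \<in> SPD" and T: "T \<in> SPD"
  shows "interpolation T t ** A ** interpolation T t = (1 - t)\<^sup>2 *\<^sub>R A
    + (t * (1 - t)) *\<^sub>R (positive_sqrt (A ** (T ** A ** T)) + positive_sqrt (T ** A ** T ** A))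
    + t\<^sup>2 *\<^sub>R (T ** A ** T)"
proof -
  have "interpolation T t = (1 - t) *\<^sub>R mat 1 + t *\<^sub>R T"
    by (simp add: interpolation_def algebra_simps)
  moreover have "positive_sqrt (A ** (T ** A ** T)) = A ** T" "positive_sqrt (T ** A ** T ** A) = T ** A"
    using positive_sqrt_SPD_product[OF A T] positive_sqrt_SPD_product[OF T A]
    by (simp_all only: matrix_mul_assoc)
  ultimately show ?thesis
    by (simp add: matmul_simps power2_eq_square scaleR_add_right mult.commute add_ac)
qed

theorem corollary3p2:
  shows "geodesically_convex (Sym :: (real^'n^'n) set) SPD wasserstein_metric \<and>
    (\<forall>A1 \<in> (SPD :: (real^'n^'n) set). \<forall>A2 \<in> SPD.
      let \<gamma> = (\<lambda>t::real. (1 - t)\<^sup>2 *\<^sub>R A1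
                + (t * (1 - t)) *\<^sub>R (positive_sqrt (A1 ** A2) + positive_sqrt (A2 ** A1))
                + t\<^sup>2 *\<^sub>R A2)
      in minimal_geodesic Sym SPD wasserstein_metric A1 A2 \<gamma> \<and>
         (\<forall>t\<in>{0..1}. \<gamma> t \<in> SPD))"
proof -
  have geod: "minimal_geodesic Sym SPD wasserstein_metric A1 A2
      (\<lambda>t. (1 - t)\<^sup>2 *\<^sub>R A1
        + (t * (1 - t)) *\<^sub>R (positive_sqrt (A1 ** A2) + positive_sqrt (A2 ** A1)) + t\<^sup>2 *\<^sub>R A2) \<and>
    (\<forall>t\<in>{0..1}. (1 - t)\<^sup>2 *\<^sub>R A1
        + (t * (1 - t)) *\<^sub>R (positive_sqrt (A1 ** A2) + positive_sqrt (A2 ** A1)) + t\<^sup>2 *\<^sub>R A2 \<in> SPD)"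
    if A1: "A1 \<in> SPD" and A2: "A2 \<in> SPD" for A1 A2 :: "real^'n^'n"
  proof -
    obtain T where T: "T \<in> SPD" "T ** A1 ** T = A2"
      using SPD_transport_exists[OF A1 A2] .
    show ?thesis
      using minimal_geodesic_wasserstein[OF A1 T(1)] wasserstein_geodesic_SPD[OF A1 T(1)]
      unfolding interpolation_congruence_positive_sqrt[OF A1 T(1)] T(2) by blast
  qed
  then show ?thesis
    unfolding geodesically_convex_def Let_def by blast
qed

end
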